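(* Let $k\ge 2$ and let $\mathbb{G}=\mathbb{R}^{m_1}\times\dots\times\mathbb{R}^{m_k}$ be a Carnot group of step $k$. Let $0<s<m_k$ and let $A\subset\mathbb{G}$ be such that $\mathcal{H}^s_E(A)<\infty$. Then for $\mathcal{H}^{ks}_{\mathbb{G}}$-almost every $p\in A$ there exists $\delta>0$ such that $$\limsup_{r\to 0}\frac{\mathcal{H}^s_E\big((A\cap B_E(p,r))\setminus V(p)(\delta r)\big)}{(2r)^s}>0.$$
   Context: Carnot groups of step $k$. A Carnot group of step $k\ge2$ is a connected, simply connected Lie group $\mathbb{G}$ whose Lie algebra $\mathfrak{g}$ has a decomposition $\mathfrak{g}=V_1\oplus\dots\oplus V_k$ with $[V_1,V_i]=V_{i+1}$ for all $i\ge 1$, where $V_k\ne\{0\}$ and $V_i=\{0\}$ for $i>k$. Put $m_i=\dim V_i$ and $n=m_1+\dots+m_k$. Using exponential coordinates (with a basis of $\mathfrak{g}$ adapted to the decomposition), $\mathbb{G}$ is identified with $\mathbb{R}^n=\mathbb{R}^{m_1}\times\dots\times\mathbb{R}^{m_k}$, points are written $p=[p^1,\dots,p^k]$ with $p^j\in\mathbb{R}^{m_j}$, and the group operation has the form $$p\cdot q=[p^1+q^1,\;p^2+q^2+P_2(p,q),\dots,p^k+q^k+P_k(p,q)],$$ where $P_j=(P_{j,1},\dots,P_{j,m_j})$ and each $P_{j,i}$ is a polynomial, homogeneous of degree $j$ with respect to the dilations $\delta_\lambda(p)=[\lambda p^1,\lambda^2p^2,\dots,\lambda^kp^k]$, $\lambda>0$,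 depending only on $p^1,\dots,p^{j-1},q^1,\dots,q^{j-1}$, and satisfying $P_{j,i}(p,0)=P_{j,i}(0,q)=0$ and $P_{j,i}(p,p)=P_{j,i}(p,-p)=0$. In particular the identity is $0$ and $p^{-1}=-p$. Metrics. $d_E$ is the Euclidean metric on $\mathbb{R}^n$ and $|\cdot|$ the Euclidean norm; $B_E(p,r)$ is the closed Euclidean ball of center $p$ and radius $r$. The homogeneous metric is $d_\infty(p,q)=\|q^{-1}\cdot p\|$, where $$\|p\|=\max\{|p^1|,\;\epsilon_2|p^2|^{1/2},\dots,\epsilon_k|p^k|^{1/k}\}$$ and $\epsilon_2,\dots,\epsilon_k\in(0,1)$ are suitable fixed constants, depending only on the group structure, for which $d_\infty$ is a metric (it is then left-invariant, one-homogeneous with respect to $\delta_\lambda$, and bi-Lipschitz equivalent to the Carnot–Carathéodory metric). Horizontal planes. For $p\in\mathbb{G}$, $V(p)$ is the left translate by $p$ of the horizontal layer: $V(p)=\{p\cdot[v,0,\dots,0]: v\in\mathbb{R}^{m_1}\}$. For $\delta>0$, $V(p)(\delta)$ is the set of $q\in\mathbb{G}$ whose Euclidean distance from $V(p)$ is $\le\delta$. Hausdorff measures. For a metric $d$ and $0<s<\infty$, $\mathcal{H}^s(A)=\lim_{\delta\to0}\mathcal{H}^s_\delta(A)$ with $\mathcal{H}^s_\delta(A)=\inf\{\sum_{j=1}^\infty\operatorname{diam}_d(A_j)^s: A\subset\bigcup_j A_j,\ \operatorname{diam}_d(A_j)<\delta\}$ (no normalizing constant). $\mathcal{H}^s_E$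 and $\mathcal{H}^s_{\mathbb{G}}$ denote the $s$-dimensional Hausdorff (outer) measures with respect to $d_E$ and $d_\infty$ respectively. *)

theory Defs
  imports "HOL-Analysis.Analysis"
begin

section \<open>Carnot groups in exponential coordinates\<close>

text \<open>
  The splitting of \<open>\<real>\<^sup>n\<close> into the blocks \<open>p\<^sup>1, \<dots>, p\<^sup>k\<close> is given on \<open>real ^ 'n\<close> by a function \<open>deg :: 'n \<Rightarrow> nat\<close>;
  the coordinates of the \<open>j\<close>-th block are those of degree \<open>j\<close>.  As the norm of \<open>real ^ 'n\<close>
  is the Euclidean one, \<open>norm (block deg j p)\<close> is the Euclidean norm of \<open>p\<^sup>j\<close>.
\<close>

definition block :: "('n::finite \<Rightarrow> nat) \<Rightarrow> nat \<Rightarrow> real ^ 'n \<Rightarrow> real ^ 'n" where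
  "block deg j p = (\<chi> i. if deg i = j then p $ i else 0)"

definition layer :: "('n::finite \<Rightarrow> nat) \<Rightarrow> nat \<Rightarrow> (real ^ 'n) set" where
  "layer deg j = {v. \<forall>i. deg i \<noteq> j \<longrightarrow> v $ i = 0}"

definition dilation :: "('n::finite \<Rightarrow> nat) \<Rightarrow> real \<Rightarrow> real ^ 'n \<Rightarrow> real ^ 'n" where
  "dilation deg c p = (\<chi> i. c ^ deg i * p $ i)"

definition gmult :: "(real ^ 'n \<Rightarrow> real ^ 'n \<Rightarrow> real ^ 'n) \<Rightarrow> real ^ 'n \<Rightarrow> real ^ 'n \<Rightarrow> real ^ 'n::finite" where
  "gmult P p q = p + q + P p q"

definition left_invariant_field ::
    "(real ^ 'n \<Rightarrow> real ^ 'n \<Rightarrow> real ^ 'n) \<Rightarrow> real ^ 'n \<Rightarrow> real ^ 'n \<Rightarrow> real ^ 'n::finite" where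
  "left_invariant_field P v p = frechet_derivative (gmult P p) (at 0) v"

definition field_bracket ::
    "(real ^ 'n \<Rightarrow> real ^ 'n) \<Rightarrow> (real ^ 'n \<Rightarrow> real ^ 'n) \<Rightarrow> real ^ 'n \<Rightarrow> real ^ 'n::finite" where
  "field_bracket X Y p = frechet_derivative Y (at p) (X p) - frechet_derivative X (at p) (Y p)"

text \<open>
  The Lie algebra is the tangent space \<open>real ^ 'n\<close> at the identity \<open>0\<close>, a vector \<open>v\<close> being
  identified with the left invariant vector field whose value at \<open>0\<close> is \<open>v\<close>.
\<close>

definition lie_bracket ::
    "(real ^ 'n \<Rightarrow> real ^ 'n \<Rightarrow> real ^ 'n) \<Rightarrow> real ^ 'n \<Rightarrow> real ^ 'n \<Rightarrow> real ^ 'n::finite" where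
  "lie_bracket P v w = field_bracket (left_invariant_field P v) (left_invariant_field P w) 0"

text \<open>
  A Carnot group of step \<open>k\<close>, written in exponential coordinates with respect to a basis adapted
  to the stratification.  That the coordinates are exponential is encoded by \<open>P_diag\<close>: the
  one-parameter subgroup \<open>\<phi>\<close> with velocity \<open>v\<close> is polynomial, because the group law is
  triangular, and it satisfies \<open>\<phi> (2 * t) = gmult P (\<phi> t) (\<phi> t) = 2 *\<^sub>R \<phi> t\<close>; so \<open>\<phi> t = t *\<^sub>R v\<close>.
  No \<open>P\<close> appears in the first block: \<open>P_lower\<close> makes it constant there, and \<open>P_right\<close> makes it zero.
\<close>

locale carnot_group =
  fixes k :: nat
    and deg :: "'n::finite \<Rightarrow> nat"
    and P :: "real ^ 'n \<Rightarrow> real ^ 'n \<Rightarrow> real ^ 'n"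
  assumes step: "k \<ge> 2"
    and deg_range: "1 \<le> deg i" "deg i \<le> k"
    and P_polynomial: "real_polynomial_function (\<lambda>(p, q). P p q $ i)"
    and P_homogeneous: "c > 0 \<Longrightarrow> P (dilation deg c p) (dilation deg c q) $ i = c ^ deg i * P p q $ i"
    and P_lower: "(\<And>l. deg l < deg i \<Longrightarrow> p $ l = p' $ l \<and> q $ l = q' $ l) \<Longrightarrow> P p q $ i = P p' q' $ i"
    and P_right: "P p 0 = 0"
    and P_left: "P 0 q = 0"
    and P_diag: "P p p = 0"
    and P_antidiag: "P p (- p) = 0"
    and assoc: "gmult P (gmult P p q) r = gmult P p (gmult P q r)"
    and stratified: "j \<ge> 1 \<Longrightarrow>
      span {lie_bracket P v w |v w. v \<in> layer deg 1 \<and> w \<in> layer deg j} = layer deg (Suc j)"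
    and top_layer: "layer deg k \<noteq> {0}"
begin

sublocale group "gmult P" 0 uminus
proof
  show "gmult P (gmult P a b) c = gmult P a (gmult P b c)" for a b c by (rule assoc)
  show "gmult P 0 a = a" for a by (simp add: gmult_def P_left)
  show "gmult P (- a) a = 0" for a using P_antidiag[of "- a"] by (simp add: gmult_def)
qed

end

definition layer_dim :: "('n::finite \<Rightarrow> nat) \<Rightarrow> nat \<Rightarrow> nat" where
  "layer_dim deg j = card {i. deg i = j}"

lemma dim_layer: "dim (layer deg j) = layer_dim deg j"
proof -
  have "layer deg j = {x. \<forall>i. i \<notin> {i. deg i = j} \<longrightarrow> x $ i = 0}"
    by (simp add: layer_def)
  then show ?thesis
    unfolding layer_dim_def using dim_substandard_cart[of "{i. deg i = j}", where 'a = real]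
    by (simp add: dim_vec_eq)
qed

section \<open>The homogeneous metric and horizontal planes\<close>

definition homogeneous_norm ::
    "nat \<Rightarrow> ('n::finite \<Rightarrow> nat) \<Rightarrow> (nat \<Rightarrow> real) \<Rightarrow> real ^ 'n \<Rightarrow> real" where
  "homogeneous_norm k deg \<epsilon> p =
    Max (insert (norm (block deg 1 p)) ((\<lambda>j. \<epsilon> j * root j (norm (block deg j p))) ` {2..k}))"

definition dist_inf ::
    "nat \<Rightarrow> ('n::finite \<Rightarrow> nat) \<Rightarrow> (real ^ 'n \<Rightarrow> real ^ 'n \<Rightarrow> real ^ 'n) \<Rightarrow> (nat \<Rightarrow> real)
      \<Rightarrow> real ^ 'n \<Rightarrow> real ^ 'n \<Rightarrow> real" where
  "dist_inf k deg P \<epsilon> p q = homogeneous_norm k deg \<epsilon> (gmult P (- q) p)"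

definition horizontal_plane ::
    "('n::finite \<Rightarrow> nat) \<Rightarrow> (real ^ 'n \<Rightarrow> real ^ 'n \<Rightarrow> real ^ 'n) \<Rightarrow> real ^ 'n \<Rightarrow> (real ^ 'n) set" where
  "horizontal_plane deg P p = gmult P p ` layer deg 1"

definition euclidean_nbhd :: "(real ^ 'n::finite) set \<Rightarrow> real \<Rightarrow> (real ^ 'n) set" where
  "euclidean_nbhd S \<delta> = {q. infdist q S \<le> \<delta>}"

section \<open>Hausdorff measures\<close>

text \<open>
  Diameters take values in \<open>[0, \<infinity>]\<close>, the diameter of the empty set being \<open>0\<close>.  Only sets of
  finite diameter occur in the covers below, so that \<open>enn2real\<close> loses nothing there.
\<close>

definition ediam :: "('a \<Rightarrow> 'a \<Rightarrow> real) \<Rightarrow> 'a set \<Rightarrow> ennreal" where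
  "ediam d S = (SUP x\<in>S. SUP y\<in>S. ennreal (d x y))"

definition hausdorff_content :: "('a \<Rightarrow> 'a \<Rightarrow> real) \<Rightarrow> real \<Rightarrow> real \<Rightarrow> 'a set \<Rightarrow> ennreal" where
  "hausdorff_content d s \<delta> A =
    Inf {\<Sum>j. ennreal (enn2real (ediam d (C j)) powr s) |C :: nat \<Rightarrow> 'a set.
           A \<subseteq> (\<Union>j. C j) \<and> (\<forall>j. ediam d (C j) < ennreal \<delta>)}"

definition hausdorff_measure :: "('a \<Rightarrow> 'a \<Rightarrow> real) \<Rightarrow> real \<Rightarrow> 'a set \<Rightarrow> ennreal" where
  "hausdorff_measure d s A = Lim (at_right 0) (\<lambda>\<delta>. hausdorff_content d s \<delta> A)"

lemma hausdorff_content_antimono: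
  assumes "\<delta> \<le> \<delta>'"
  shows "hausdorff_content d s \<delta>' A \<le> hausdorff_content d s \<delta> A"
  unfolding hausdorff_content_def
  by (rule Inf_superset_mono) (use assms in \<open>auto intro: less_le_trans ennreal_leI\<close>)

lemma tendsto_hausdorff_content_SUP:
  "((\<lambda>\<delta>. hausdorff_content d s \<delta> A) \<longlongrightarrow> (SUP \<delta>\<in>{0<..}. hausdorff_content d s \<delta> A)) (at_right 0)"
proof (rule increasing_tendsto)
  show "\<forall>\<^sub>F \<delta> in at_right 0. hausdorff_content d s \<delta> A \<le> (SUP \<delta>\<in>{0<..}. hausdorff_content d s \<delta> A)"
    by (auto simp: eventually_at_right_field intro!: exI[of _ 1] SUP_upper)
next
  fix x assume "x < (SUP \<delta>\<in>{0<..}. hausdorff_content d s \<delta> A)"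
  then obtain e where e: "e > 0" "x < hausdorff_content d s e A"
    by (auto simp: less_SUP_iff)
  have "x < hausdorff_content d s \<delta> A" if "\<delta> < e" for \<delta>
    using e(2) hausdorff_content_antimono[of \<delta> e d s A] that by (simp add: less_le_trans)
  with e(1) show "\<forall>\<^sub>F \<delta> in at_right 0. x < hausdorff_content d s \<delta> A"
    by (auto simp: eventually_at_right_field)
qed

lemma hausdorff_measure_eq_SUP:
  "hausdorff_measure d s A = (SUP \<delta>\<in>{0<..}. hausdorff_content d s \<delta> A)"
  unfolding hausdorff_measure_def
  by (rule tendsto_Lim[OF _ tendsto_hausdorff_content_SUP]) simp

end

theory Submission
  imports Defs
begin

text \<open>
  Suppose that near \<open>p\<close> the set \<open>A\<close> is concentrated along \<open>V(p)\<close>.  A point of \<open>V(p)\<close> within Euclidean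
  distance \<open>3r\<close> of \<open>p\<close> is also within \<open>d\<^sub>\<infinity>\<close>-distance \<open>3r\<close> of \<open>p\<close>, and locally
  \<open>d\<^sub>\<infinity> \<le> C d\<^sub>E\<^bsup>1/k\<^esup>\<close>; so \<open>B\<^sub>E(p,r) \<inter> V(p)(\<delta>r)\<close> lies in one \<open>d\<^sub>\<infinity>\<close>-ball of radius \<open>\<kappa> r\<^bsup>1/k\<^esup>\<close>, with \<open>\<kappa>\<close>
  arbitrarily small.  This ball contributes \<open>(2\<kappa>)\<^bsup>ks\<^esup> r\<^sup>s\<close> to the measure of dimension \<open>ks\<close>, and the rest of
  \<open>A \<inter> B\<^sub>E(p,r)\<close> contributes at most a constant times its Euclidean measure, which is at most \<open>\<eta> r\<^sup>s\<close>.
  Summing over an almost optimal Euclidean cover of the exceptional set \<open>B\<close> bounds its \<open>ks\<close>-dimensional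
  measure by an arbitrarily small multiple of the \<open>s\<close>-dimensional Euclidean measure of \<open>A\<close>.

  The scale below which concentration holds depends on \<open>p\<close>.  The set of points sharing a given
  scale is replaced by its closure, at the price of constant factors, because \<open>A\<close> is arbitrary but its
  Euclidean measure is additive over differences of closed sets.
\<close>

section \<open>Hausdorff contents and measures\<close>

lemma ediam_leI:
  assumes "\<And>x y. x \<in> S \<Longrightarrow> y \<in> S \<Longrightarrow> d x y \<le> c"
  shows "ediam d S \<le> ennreal c"
  unfolding ediam_def using assms by (intro SUP_least ennreal_leI)

lemma ediam_upper:
  assumes "x \<in> S" "y \<in> S"
  shows "ennreal (d x y) \<le> ediam d S"
  unfolding ediam_def using assms by (intro SUP_upper2[of x] SUP_upper2[of y]) auto

lemma ediam_empty [simp]: "ediam d {} = 0"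
  by (simp add: ediam_def bot_ennreal)

lemma enn2real_ediam_leI:
  assumes "\<And>x y. x \<in> S \<Longrightarrow> y \<in> S \<Longrightarrow> d x y \<le> c" "0 \<le> c"
  shows "enn2real (ediam d S) \<le> c"
  using enn2real_mono[OF ediam_leI[of S d c]] assms by simp

text \<open>The bound by \<open>\<delta>\<close> guarantees a finite diameter, since
  \<open>enn2real\<close> would send an infinite one to 0. No metric axiom is assumed of
  \<open>d\<close>, so negative values, which \<open>ennreal\<close> truncates to 0, form a separate
  case.\<close>

lemma dist_le_enn2real_ediam:
  assumes "ediam d S < ennreal \<delta>" "x \<in> S" "y \<in> S"
  shows "d x y \<le> enn2real (ediam d S)"
proof (cases "0 \<le> d x y")
  case True
  have "ediam d S < top" using assms(1) by (simp add: less_top order_less_trans)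
  then show ?thesis
    using enn2real_mono[OF ediam_upper[OF assms(2,3)]] True by (metis enn2real_ennreal)
next
  case False
  then show ?thesis using enn2real_nonneg[of "ediam d S"] by linarith
qed

lemma hausdorff_content_le_suminf:
  assumes "A \<subseteq> (\<Union>j. C j)" "\<And>j. ediam d (C j) < ennreal \<delta>"
  shows "hausdorff_content d s \<delta> A \<le> (\<Sum>j. ennreal (enn2real (ediam d (C j)) powr s))"
  unfolding hausdorff_content_def using assms by (intro Inf_lower) blast

lemma hausdorff_content_approx:
  fixes d :: "'a \<Rightarrow> 'a \<Rightarrow> real"
  assumes "hausdorff_content d s \<delta> A < \<infinity>" "0 < e"
  obtains C where "A \<subseteq> (\<Union>j. C j)" "\<And>j. ediam d (C j) < ennreal \<delta>"
    "(\<Sum>j. ennreal (enn2real (ediam d (C j)) powr s)) \<le> hausdorff_content d s \<delta> A + ennreal e"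
proof -
  have "hausdorff_content d s \<delta> A < hausdorff_content d s \<delta> A + ennreal e"
    using assms by (simp add: ennreal_add_left_cancel_less[of _ 0, simplified])
  then have "\<exists>y\<in>{\<Sum>j. ennreal (enn2real (ediam d (C j)) powr s) |C :: nat \<Rightarrow> 'a set.
      A \<subseteq> (\<Union>j. C j) \<and> (\<forall>j. ediam d (C j) < ennreal \<delta>)}.
      y < hausdorff_content d s \<delta> A + ennreal e"
    by (subst (asm) (1) hausdorff_content_def) (simp only: Inf_less_iff)
  then obtain C where "A \<subseteq> (\<Union>j. C j)" "\<forall>j. ediam d (C j) < ennreal \<delta>"
    "(\<Sum>j. ennreal (enn2real (ediam d (C j)) powr s)) < hausdorff_content d s \<delta> A + ennreal e"
    by blast
  then show thesis by (intro that[of C]) (simp_all add: less_imp_le)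
qed

lemma hausdorff_content_mono:
  "A \<subseteq> B \<Longrightarrow> hausdorff_content d s \<delta> A \<le> hausdorff_content d s \<delta> B"
  unfolding hausdorff_content_def by (rule Inf_superset_mono) auto

text \<open>The set covers itself; the cover is padded with empty sets, which contribute nothing
  because \<open>0 powr s = 0\<close>.\<close>

lemma hausdorff_content_le_diam:
  assumes "\<And>x y. x \<in> S \<Longrightarrow> y \<in> S \<Longrightarrow> d x y \<le> c" "0 \<le> c" "c < \<delta>" "0 < s"
  shows "hausdorff_content d s \<delta> S \<le> ennreal (c powr s)"
proof -
  define C where "C = (\<lambda>j::nat. if j = 0 then S else {})"
  have "hausdorff_content d s \<delta> S \<le> (\<Sum>j. ennreal (enn2real (ediam d (C j)) powr s))"
  proof (rule hausdorff_content_le_suminf)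
    show "S \<subseteq> (\<Union>j. C j)" by (auto simp: C_def)
    have "ediam d S < ennreal \<delta>"
      using ediam_leI[of S d c, OF assms(1)] assms(2,3) by (simp add: ennreal_lessI order_le_less_trans)
    then show "ediam d (C j) < ennreal \<delta>" for j
      using assms(2,3) by (simp add: C_def)
  qed
  also have "\<dots> = (\<Sum>j\<in>{0}. ennreal (enn2real (ediam d (C j)) powr s))"
    by (rule suminf_finite) (auto simp: C_def)
  also have "\<dots> \<le> ennreal (c powr s)"
    using enn2real_ediam_leI[of S d c, OF assms(1,2)] assms(4)
    by (simp add: C_def ennreal_leI powr_mono2)
  finally show ?thesis .
qed

lemma suminf_geometric_half_ennreal:
  assumes "0 \<le> e"
  shows "(\<Sum>n. ennreal (e * (1 / 2) ^ Suc n)) = ennreal e"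
  using sums_mult[OF power_half_series, of e] assms
  by (intro suminf_ennreal_eq) auto

text \<open>Almost optimal covers of the \<open>A n\<close>, with errors
  \<open>e * (1/2)^Suc n\<close> of total \<open>e\<close>, are merged into a single sequence by
  \<open>prod_decode\<close>. \<open>ennreal_le_epsilon\<close> leaves only the case of a finite
  sum, in which every \<open>A n\<close> has such a cover.\<close>

lemma hausdorff_content_UN:
  "hausdorff_content d s \<delta> (\<Union>n. A n) \<le> (\<Sum>n. hausdorff_content d s \<delta> (A n))"
proof (rule ennreal_le_epsilon)
  fix e :: real assume e: "0 < e" and sum: "(\<Sum>n. hausdorff_content d s \<delta> (A n)) < top"
  have fin: "hausdorff_content d s \<delta> (A n) < \<infinity>" for n
    using ennreal_suminf_lessD[OF sum] by simp
  have "\<exists>C. A n \<subseteq> (\<Union>j. C j) \<and> (\<forall>j. ediam d (C j) < ennreal \<delta>) \<and>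
     (\<Sum>j. ennreal (enn2real (ediam d (C j)) powr s))
       \<le> hausdorff_content d s \<delta> (A n) + ennreal (e * (1/2)^Suc n)" for n
    by (rule hausdorff_content_approx[OF fin, of "e * (1/2)^Suc n"]) (use e in auto)
  then obtain C where C: "\<And>n. A n \<subseteq> (\<Union>j. C n j)" "\<And>n j. ediam d (C n j) < ennreal \<delta>"
    "\<And>n. (\<Sum>j. ennreal (enn2real (ediam d (C n j)) powr s))
       \<le> hausdorff_content d s \<delta> (A n) + ennreal (e * (1/2)^Suc n)"
    by metis
  define K where "K = (\<lambda>i. case prod_decode i of (n, j) \<Rightarrow> C n j)"
  have "hausdorff_content d s \<delta> (\<Union>n. A n) \<le> (\<Sum>j. ennreal (enn2real (ediam d (K j)) powr s))"
  proof (rule hausdorff_content_le_suminf)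
    show "(\<Union>n. A n) \<subseteq> (\<Union>j. K j)"
    proof
      fix x assume "x \<in> (\<Union>n. A n)"
      then obtain n j where "x \<in> C n j" using C(1) by blast
      then have "x \<in> K (prod_encode (n, j))" by (simp add: K_def)
      then show "x \<in> (\<Union>j. K j)" by blast
    qed
    show "ediam d (K j) < ennreal \<delta>" for j
      by (simp add: K_def C(2) split: prod.split)
  qed
  also have "\<dots> = (\<Sum>n. \<Sum>j. ennreal (enn2real (ediam d (C n j)) powr s))"
  proof -
    have "(\<lambda>j. ennreal (enn2real (ediam d (K j)) powr s))
        = (\<lambda>j. (\<lambda>p. ennreal (enn2real (ediam d (C (fst p) (snd p))) powr s)) (prod_decode j))"
      by (simp add: K_def case_prod_unfold)
    then show ?thesis
      by (simp only:) (rule suminf_ennreal_2dimen, simp)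
  qed
  also have "\<dots> \<le> (\<Sum>n. hausdorff_content d s \<delta> (A n) + ennreal (e * (1/2)^Suc n))"
    by (intro suminf_le C(3)) auto
  also have "\<dots> = (\<Sum>n. hausdorff_content d s \<delta> (A n)) + ennreal e"
    using suminf_geometric_half_ennreal[of e] e by (subst suminf_add[symmetric]) (simp_all del: power_Suc suminf_ennreal2 suminf_ennreal)
  finally show "hausdorff_content d s \<delta> (\<Union>n. A n) \<le> (\<Sum>n. hausdorff_content d s \<delta> (A n)) + ennreal e" .
qed

lemma hausdorff_content_le_measure:
  "0 < \<delta> \<Longrightarrow> hausdorff_content d s \<delta> A \<le> hausdorff_measure d s A"
  by (auto simp: hausdorff_measure_eq_SUP intro: SUP_upper)

lemma hausdorff_measure_leI:
  "(\<And>\<delta>. 0 < \<delta> \<Longrightarrow> hausdorff_content d s \<delta> A \<le> c) \<Longrightarrow> hausdorff_measure d s A \<le> c"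
  by (auto simp: hausdorff_measure_eq_SUP intro: SUP_least)

lemma hausdorff_measure_mono:
  "A \<subseteq> B \<Longrightarrow> hausdorff_measure d s A \<le> hausdorff_measure d s B"
  by (meson hausdorff_measure_leI hausdorff_content_le_measure hausdorff_content_mono order_trans)

lemma hausdorff_measure_UN:
  "hausdorff_measure d s (\<Union>n. A n) \<le> (\<Sum>n. hausdorff_measure d s (A n))"
proof (rule hausdorff_measure_leI)
  fix \<delta> :: real assume "0 < \<delta>"
  then have "(\<Sum>n. hausdorff_content d s \<delta> (A n)) \<le> (\<Sum>n. hausdorff_measure d s (A n))"
    by (intro suminf_le hausdorff_content_le_measure) auto
  then show "hausdorff_content d s \<delta> (\<Union>n. A n) \<le> (\<Sum>n. hausdorff_measure d s (A n))"
    using hausdorff_content_UN order_trans by blast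
qed

lemma Un_eq_UN_nat: "A \<union> B = (\<Union>n::nat. if n = 0 then A else if n = 1 then B else {})"
  by (auto split: if_splits)

lemma suminf_two: "(\<Sum>n::nat. if n = 0 then a else if n = 1 then b else (0::ennreal)) = a + b"
proof -
  have "(\<Sum>n::nat. if n = 0 then a else if n = 1 then b else (0::ennreal))
     = (\<Sum>n\<in>{0, 1::nat}. if n = 0 then a else if n = 1 then b else 0)"
    by (rule suminf_finite) auto
  then show ?thesis by simp
qed

lemma hausdorff_content_empty:
  assumes "0 < \<delta>"
  shows "hausdorff_content d s \<delta> {} = 0"
  using hausdorff_content_le_suminf[of "{}" "\<lambda>_. {}" d \<delta> s] assms by simp

lemma hausdorff_measure_empty [simp]: "hausdorff_measure d s {} = 0"
  using hausdorff_measure_leI[of d s "{}" 0] by (simp add: hausdorff_content_empty)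

lemma hausdorff_content_Un:
  assumes "0 < \<delta>"
  shows "hausdorff_content d s \<delta> (A \<union> B) \<le> hausdorff_content d s \<delta> A + hausdorff_content d s \<delta> B"
proof -
  have "hausdorff_content d s \<delta> (A \<union> B)
      \<le> (\<Sum>n::nat. hausdorff_content d s \<delta> (if n = 0 then A else if n = 1 then B else {}))"
    by (subst Un_eq_UN_nat) (rule hausdorff_content_UN)
  also have "\<dots> = (\<Sum>n::nat. if n = 0 then hausdorff_content d s \<delta> A
      else if n = 1 then hausdorff_content d s \<delta> B else 0)"
    by (rule suminf_cong) (simp add: hausdorff_content_empty assms)
  finally show ?thesis by (simp only: suminf_two)
qed

lemma hausdorff_measure_Un:
  "hausdorff_measure d s (A \<union> B) \<le> hausdorff_measure d s A + hausdorff_measure d s B"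
proof (rule hausdorff_measure_leI)
  fix \<delta> :: real assume "0 < \<delta>"
  then show "hausdorff_content d s \<delta> (A \<union> B) \<le> hausdorff_measure d s A + hausdorff_measure d s B"
    by (intro order_trans[OF hausdorff_content_Un] add_mono hausdorff_content_le_measure)
qed

section \<open>Additivity over separated sets and over differences of closed sets\<close>

lemma hausdorff_content_separated:
  assumes sep: "\<And>x y. x \<in> A \<Longrightarrow> y \<in> B \<Longrightarrow> \<delta> \<le> d x y" and "0 < \<delta>"
  shows "hausdorff_content d s \<delta> A + hausdorff_content d s \<delta> B \<le> hausdorff_content d s \<delta> (A \<union> B)"
  unfolding hausdorff_content_def[of d s \<delta> "A \<union> B"]
proof (rule Inf_greatest, clarify)
  fix C :: "nat \<Rightarrow> _" assume C: "A \<union> B \<subseteq> (\<Union>j. C j)" "\<forall>j. ediam d (C j) < ennreal \<delta>"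
  \<comment> \<open>A covering set of diameter below \<open>\<delta>\<close> cannot meet both
    \<open>A\<close> and \<open>B\<close>, so the cover splits into a cover of each. Discarded
    members become empty sets, which keeps the indexing.\<close>
  define CA where "CA = (\<lambda>j. if C j \<inter> A = {} then {} else C j)"
  define CB where "CB = (\<lambda>j. if C j \<inter> B = {} then {} else C j)"
  let ?f = "\<lambda>S. ennreal (enn2real (ediam d S) powr s)"
  have one: "C j \<inter> A = {} \<or> C j \<inter> B = {}" for j
  proof (rule ccontr)
    assume "\<not> ?thesis"
    then obtain x y where "x \<in> C j" "x \<in> A" "y \<in> C j" "y \<in> B" by blast
    then have "ennreal (d x y) \<le> ediam d (C j)" "\<delta> \<le> d x y"
      by (auto intro: ediam_upper sep)
    then have "ennreal \<delta> \<le> ediam d (C j)" by (meson ennreal_leI order_trans)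
    then show False using C(2) by (simp add: linorder_not_le[symmetric])
  qed
  have small: "ediam d (CA j) < ennreal \<delta>" "ediam d (CB j) < ennreal \<delta>" for j
    using C(2) \<open>0 < \<delta>\<close> by (auto simp: CA_def CB_def)
  have "hausdorff_content d s \<delta> A + hausdorff_content d s \<delta> B \<le> (\<Sum>j. ?f (CA j)) + (\<Sum>j. ?f (CB j))"
  proof (intro add_mono hausdorff_content_le_suminf small)
    show "A \<subseteq> (\<Union>j. CA j)" "B \<subseteq> (\<Union>j. CB j)"
      using C(1) by (auto simp: CA_def CB_def subset_iff Ball_def) (metis disjoint_iff)+
  qed
  also have "\<dots> = (\<Sum>j. ?f (CA j) + ?f (CB j))" by (intro suminf_add) auto
  also have "\<dots> \<le> (\<Sum>j. ?f (C j))"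
    using one by (intro suminf_le) (auto simp: CA_def CB_def)
  finally show "hausdorff_content d s \<delta> A + hausdorff_content d s \<delta> B \<le> (\<Sum>j. ?f (C j))" .
qed

lemma hausdorff_measure_separated:
  assumes sep: "\<And>x y. x \<in> A \<Longrightarrow> y \<in> B \<Longrightarrow> e \<le> d x y" and "0 < e"
  shows "hausdorff_measure d s A + hausdorff_measure d s B \<le> hausdorff_measure d s (A \<union> B)"
proof (rule tendsto_upperbound)
  show "((\<lambda>\<delta>. hausdorff_content d s \<delta> A + hausdorff_content d s \<delta> B)
      \<longlongrightarrow> hausdorff_measure d s A + hausdorff_measure d s B) (at_right 0)"
    unfolding hausdorff_measure_eq_SUP by (intro tendsto_add tendsto_hausdorff_content_SUP)
  show "\<forall>\<^sub>F \<delta> in at_right 0. hausdorff_content d s \<delta> A + hausdorff_content d s \<delta> B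
      \<le> hausdorff_measure d s (A \<union> B)"
    unfolding eventually_at_right_field
  proof (intro exI conjI allI impI)
    fix \<delta> :: real assume "0 < \<delta>" "\<delta> < e"
    then have "\<And>x y. x \<in> A \<Longrightarrow> y \<in> B \<Longrightarrow> \<delta> \<le> d x y" using sep by fastforce
    then show "hausdorff_content d s \<delta> A + hausdorff_content d s \<delta> B
      \<le> hausdorff_measure d s (A \<union> B)"
      using \<open>0 < \<delta>\<close> by (intro order_trans[OF hausdorff_content_separated hausdorff_content_le_measure])
  qed fact
qed simp

text \<open>An almost optimal cover with real bounds \<open>t j\<close> on distances, so that the
  covering arguments below avoid \<open>ediam\<close> and \<open>enn2real\<close>.\<close>

lemma hausdorff_measure_approx:
  assumes "hausdorff_measure d s A < \<infinity>" "0 < \<delta>" "0 < e"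
  obtains V t where "A \<subseteq> (\<Union>j::nat. V j)" "\<And>j. 0 \<le> t j" "\<And>j. t j < \<delta>"
    "\<And>j x y. x \<in> V j \<Longrightarrow> y \<in> V j \<Longrightarrow> d x y \<le> t j"
    "(\<Sum>j. ennreal (t j powr s)) \<le> hausdorff_measure d s A + ennreal e"
proof -
  have le: "hausdorff_content d s \<delta> A \<le> hausdorff_measure d s A"
    using assms(2) by (rule hausdorff_content_le_measure)
  then have "hausdorff_content d s \<delta> A < \<infinity>"
    using assms(1) by (rule order_le_less_trans)
  then obtain V where V: "A \<subseteq> (\<Union>j. V j)" "\<And>j. ediam d (V j) < ennreal \<delta>"
    "(\<Sum>j. ennreal (enn2real (ediam d (V j)) powr s)) \<le> hausdorff_content d s \<delta> A + ennreal e"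
    using hausdorff_content_approx[OF _ \<open>0 < e\<close>] by metis
  have "enn2real (ediam d (V j)) < \<delta>" for j
  proof -
    have "ediam d (V j) = ennreal (enn2real (ediam d (V j)))"
      using V(2)[of j] by (simp add: less_top order_less_trans)
    then show ?thesis using V(2)[of j] by (metis ennreal_less_iff enn2real_nonneg)
  qed
  then show thesis
    using V dist_le_enn2real_ediam[OF V(2)] order_trans[OF V(3) add_right_mono[OF le]]
    by (intro that[of V "\<lambda>j. enn2real (ediam d (V j))"]) auto
qed

text \<open>Only shells of equal parity are summed, as consecutive shells need not be separated.\<close>

lemma sum_hausdorff_measure_shells:
  fixes A F :: "'a::metric_space set"
  assumes "c > 0"
  defines "R \<equiv> \<lambda>n::nat. {x \<in> A. 1 / (real n + 1) \<le> infdist x F \<and> infdist x F < 1 / real n}"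
  shows "(\<Sum>i<N. hausdorff_measure dist s (R (2 * i + c)))
    \<le> hausdorff_measure dist s (A \<inter> (\<Union>i<N. R (2 * i + c)))"
proof (induction N)
  case (Suc N)
  let ?U = "A \<inter> (\<Union>i<N. R (2 * i + c))"
  \<comment> \<open>The last earlier shell has index \<open>2 * (N - 1) + c\<close>, so earlier
    points have distance at least \<open>1 / (2 * N + c - 1)\<close> from \<open>F\<close>, while
    new ones are closer than \<open>1 / (2 * N + c)\<close>. For \<open>N = 0\<close> there is no
    earlier shell and any positive gap will do.\<close>
  define e where "e = (if N = 0 then 1 else 1 / (2 * real N + real c - 1) - 1 / (2 * real N + real c))"
  have "0 < e" using \<open>c > 0\<close> by (simp add: e_def frac_less2)
  have sep: "e \<le> dist x y" if x: "x \<in> ?U" and y: "y \<in> R (2 * N + c)" for x y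
  proof -
    from x obtain i where i: "i < N" "x \<in> R (2 * i + c)" by blast
    have "2 * real N + real c - 1 \<ge> real (2 * i + c) + 1" using i(1) by simp
    then have "1 / (2 * real N + real c - 1) \<le> 1 / (real (2 * i + c) + 1)"
      by (intro divide_left_mono) (auto intro!: mult_pos_pos add_nonneg_pos)
    also have "\<dots> \<le> infdist x F" using i(2) by (simp add: R_def)
    finally have "1 / (2 * real N + real c - 1) \<le> infdist x F" .
    moreover have "infdist y F \<le> 1 / (2 * real N + real c)" using y by (simp add: R_def)
    moreover have "infdist x F \<le> infdist y F + dist x y" by (rule infdist_triangle)
    ultimately show ?thesis using i(1) by (simp add: e_def)
  qed
  have "(\<Sum>i<Suc N. hausdorff_measure dist s (R (2 * i + c)))
      \<le> hausdorff_measure dist s ?U + hausdorff_measure dist s (R (2 * N + c))"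
    using Suc.IH by (simp add: add_right_mono)
  also have "\<dots> \<le> hausdorff_measure dist s (?U \<union> R (2 * N + c))"
    using sep \<open>0 < e\<close> by (rule hausdorff_measure_separated)
  also have "?U \<union> R (2 * N + c) = A \<inter> (\<Union>i<Suc N. R (2 * i + c))"
    by (auto simp: R_def less_Suc_eq)
  finally show ?case .
qed simp

lemma suminf_even_odd_ennreal:
  fixes f :: "nat \<Rightarrow> ennreal"
  shows "(\<Sum>n. f n) = (\<Sum>n. f (2 * n)) + (\<Sum>n. f (2 * n + 1))"
proof -
  have "(\<Sum>i<2*n. f i) = (\<Sum>i<n. f (2 * i)) + (\<Sum>i<n. f (2 * i + 1))" for n
    by (induction n) (auto simp: algebra_simps)
  moreover have "(\<lambda>n. (\<Sum>i<n. f (2 * i)) + (\<Sum>i<n. f (2 * i + 1)))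
      \<longlonglongrightarrow> (\<Sum>n. f (2 * n)) + (\<Sum>n. f (2 * n + 1))"
    by (intro tendsto_add summable_LIMSEQ) auto
  moreover have "(\<lambda>n. \<Sum>i<2*n. f i) \<longlonglongrightarrow> (\<Sum>n. f n)"
    using LIMSEQ_subseq_LIMSEQ[OF summable_LIMSEQ[of f], of "\<lambda>n. 2 * n"]
    by (simp add: strict_mono_def comp_def)
  ultimately show ?thesis using LIMSEQ_unique by force
qed

text \<open>Caratheodory's argument: \<open>A - F\<close> is exhausted by sets \<open>B\<close> at
  positive distance from \<open>F\<close>, to which additivity over separated sets applies. What is
  left of \<open>A - F\<close> lies in shells around \<open>F\<close> whose measures form the tail
  of a convergent series.\<close>

lemma hausdorff_measure_closed_split:
  fixes F :: "'a::metric_space set"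
  assumes "closed F" and fin: "hausdorff_measure dist s A < \<infinity>"
  shows "hausdorff_measure dist s (A \<inter> F) + hausdorff_measure dist s (A - F)
    \<le> hausdorff_measure dist s A"
\<comment> \<open>The empty set is treated apart because \<open>infdist x {} = 0\<close> by
  convention.\<close>
proof (cases "F = {}")
  case False
  let ?H = "hausdorff_measure dist s"
  define R where "R = (\<lambda>n::nat. {x \<in> A. 1 / (real n + 1) \<le> infdist x F \<and> infdist x F < 1 / real n})"
  have odd_even: "(\<Sum>i. ?H (R (2 * i + c))) \<le> ?H A" if "c > 0" for c
  proof (rule suminf_le_const)
    fix N
    have "(\<Sum>i<N. ?H (R (2 * i + c))) \<le> ?H (A \<inter> (\<Union>i<N. R (2 * i + c)))"
      unfolding R_def by (rule sum_hausdorff_measure_shells[OF that])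
    also have "\<dots> \<le> ?H A" by (rule hausdorff_measure_mono) auto
    finally show "(\<Sum>i<N. ?H (R (2 * i + c))) \<le> ?H A" .
  qed auto
  \<comment> \<open>Numbering starts at 1, as \<open>1 / real 0 = 0\<close> makes \<open>R 0\<close>
    empty; the two parities are the cases \<open>c = 1\<close> and \<open>c = 2\<close> of the shell
    estimate.\<close>
  have "(\<Sum>n. ?H (R (n + 1))) = (\<Sum>i. ?H (R (2 * i + 1))) + (\<Sum>i. ?H (R (2 * i + 2)))"
    by (subst suminf_even_odd_ennreal) (simp add: add.commute)
  also have "\<dots> \<le> ?H A + ?H A" by (intro add_mono odd_even) auto
  also have "\<dots> < top" using fin by simp
  finally have S: "(\<Sum>n. ?H (R (n + 1))) < top" .
  define h where "h = (\<lambda>n. enn2real (?H (R (n + 1))))"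
  have h: "?H (R (n + 1)) = ennreal (h n)" for n
    using ennreal_suminf_lessD[OF S, of n] by (simp add: h_def)
  have "summable h"
    using S unfolding h by (intro summable_suminf_not_top) (auto simp: h_def)
  show ?thesis
  proof (rule ennreal_le_epsilon)
    fix e :: real assume "0 < e"
    then obtain N where N: "\<And>n. n \<ge> N \<Longrightarrow> norm (\<Sum>i. h (i + n)) < e"
      using suminf_exist_split[OF _ \<open>summable h\<close>] by blast
    have "(\<Sum>i. h (i + N)) < e" using N[of N] by auto
    then have tail: "(\<Sum>i. ?H (R (i + N + 1))) \<le> ennreal e"
      unfolding h using summable_ignore_initial_segment[OF \<open>summable h\<close>, of N]
      by (subst suminf_ennreal2) (simp_all add: h_def ennreal_leI)
    define B where "B = {x \<in> A. 1 / (real N + 1) \<le> infdist x F}"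
    have cover: "A - F \<subseteq> B \<union> (\<Union>i. R (i + N + 1))"
    proof
      fix x assume x: "x \<in> A - F"
      show "x \<in> B \<union> (\<Union>i. R (i + N + 1))"
      proof (cases "x \<in> B")
        case False
        let ?t = "infdist x F"
        have t: "0 < ?t" "?t < 1 / (real N + 1)"
          using x False \<open>closed F\<close> \<open>F \<noteq> {}\<close> infdist_pos_not_in_closed[of F x] by (auto simp: B_def)
        \<comment> \<open>The shell containing \<open>x\<close> has the least index \<open>n\<close>
          with \<open>1 / (n + 1) \<le> ?t\<close>: minimality at \<open>n - 1\<close> gives
          \<open>?t < 1 / n\<close>, and \<open>?t < 1 / (N + 1)\<close> forces
          \<open>n > N\<close>.\<close>
        define P where "P = (\<lambda>n::nat. 1 / (real n + 1) \<le> ?t)"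
        obtain m where "inverse (real (Suc m)) < ?t" using reals_Archimedean t(1) by blast
        then have "P m" by (simp add: P_def inverse_eq_divide add.commute)
        define n where "n = (LEAST n. P n)"
        have "P n" unfolding n_def using \<open>P m\<close> by (rule LeastI)
        have "n > N"
        proof (rule ccontr)
          assume "\<not> n > N"
          then have "1 / (real N + 1) \<le> 1 / (real n + 1)" by (intro divide_left_mono) auto
          then show False using \<open>P n\<close> t(2) by (simp add: P_def)
        qed
        have "\<not> P (n - 1)" unfolding n_def using \<open>n > N\<close>
          by (intro not_less_Least) (simp add: n_def)
        then have "?t < 1 / real n" using \<open>n > N\<close> by (simp add: P_def of_nat_diff)
        then have "x \<in> R ((n - N - 1) + N + 1)"
          using \<open>P n\<close> \<open>n > N\<close> x by (simp add: R_def P_def)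
        then show ?thesis by blast
      qed simp
    qed
    have "?H (A \<inter> F) + ?H B \<le> ?H (A \<inter> F \<union> B)"
    proof (rule hausdorff_measure_separated)
      fix x y assume "x \<in> A \<inter> F" "y \<in> B"
      then show "1 / (real N + 1) \<le> dist x y"
        using infdist_le[of x F y] by (simp add: B_def dist_commute)
    qed simp
    also have "\<dots> \<le> ?H A" by (rule hausdorff_measure_mono) (auto simp: B_def)
    finally have B: "?H (A \<inter> F) + ?H B \<le> ?H A" .
    have "?H (A - F) \<le> ?H B + ?H (\<Union>i. R (i + N + 1))"
      by (rule order_trans[OF hausdorff_measure_mono[OF cover] hausdorff_measure_Un])
    also have "\<dots> \<le> ?H B + ennreal e"
      by (intro add_left_mono order_trans[OF hausdorff_measure_UN tail])
    finally have "?H (A \<inter> F) + ?H (A - F) \<le> (?H (A \<inter> F) + ?H B) + ennreal e"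
      by (simp add: add.assoc add_left_mono)
    also have "\<dots> \<le> ?H A + ennreal e" using B by (rule add_right_mono)
    finally show "?H (A \<inter> F) + ?H (A - F) \<le> ?H A + ennreal e" .
  qed
qed simp

text \<open>Each \<open>F N\<close> in turn is split off from what the earlier ones leave of
  \<open>A\<close>. The induction carries the measure of the remainder, which the next splitting
  consumes.\<close>

lemma sum_hausdorff_measure_closed_chain:
  fixes F :: "nat \<Rightarrow> 'a::metric_space set"
  assumes "\<And>n. closed (F n)" and fin: "hausdorff_measure dist s A < \<infinity>"
  shows "(\<Sum>n. hausdorff_measure dist s (A \<inter> (F n - (\<Union>i<n. F i)))) \<le> hausdorff_measure dist s A"
proof (rule suminf_le_const)
  let ?H = "hausdorff_measure dist s"
  fix N
  have "(\<Sum>n<N. ?H (A \<inter> (F n - (\<Union>i<n. F i)))) + ?H (A - (\<Union>i<N. F i)) \<le> ?H A"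
  proof (induction N)
    case (Suc N)
    let ?A' = "A - (\<Union>i<N. F i)"
    have "?H ?A' \<le> ?H A" by (rule hausdorff_measure_mono) auto
    then have "?H (?A' \<inter> F N) + ?H (?A' - F N) \<le> ?H ?A'"
      using fin assms(1) by (intro hausdorff_measure_closed_split) auto
    moreover have "?A' \<inter> F N = A \<inter> (F N - (\<Union>i<N. F i))" "?A' - F N = A - (\<Union>i<Suc N. F i)"
      by (auto simp: less_Suc_eq)
    ultimately have "(\<Sum>n<Suc N. ?H (A \<inter> (F n - (\<Union>i<n. F i)))) + ?H (A - (\<Union>i<Suc N. F i))
      \<le> (\<Sum>n<N. ?H (A \<inter> (F n - (\<Union>i<n. F i)))) + ?H ?A'"
      by (simp add: add.assoc add_left_mono)
    also have "\<dots> \<le> ?H A" by (rule Suc.IH)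
    finally show ?case .
  qed simp
  then show "(\<Sum>n<N. ?H (A \<inter> (F n - (\<Union>i<n. F i)))) \<le> ?H A"
    by (rule order_trans[rotated]) simp
qed auto

section \<open>Comparison with a H\<open>\<ddot>\<close>older equivalent metric\<close>

lemma ennreal_le_cmult_epsilon:
  assumes "\<And>e. 0 < e \<Longrightarrow> x \<le> ennreal K * (h + ennreal e)" "0 \<le> K"
  shows "x \<le> ennreal K * h"
proof (rule ennreal_le_epsilon)
  fix e :: real assume "0 < e"
  \<comment> \<open>The denominator is \<open>K + 1\<close> because \<open>K\<close> may
    vanish.\<close>
  then have "x \<le> ennreal K * (h + ennreal (e / (K + 1)))" using assms by simp
  also have "\<dots> = ennreal K * h + ennreal (K * (e / (K + 1)))"
    using assms(2) \<open>0 < e\<close> by (simp only: distrib_left) (simp add: ennreal_mult'[symmetric])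
  also have "\<dots> \<le> ennreal K * h + ennreal e"
    using assms(2) \<open>0 < e\<close> by (intro add_left_mono ennreal_leI) (simp add: field_simps)
  finally show "x \<le> ennreal K * h + ennreal e" .
qed

text \<open>A set of diameter \<open>t\<close> for \<open>dist\<close> has \<open>D\<close>-diameter
  at most \<open>C * t powr \<alpha>\<close>, whose power \<open>s / \<alpha>\<close> is
  \<open>C powr (s / \<alpha>) * t powr s\<close>.\<close>

lemma hausdorff_measure_Holder:
  fixes E :: "'a::metric_space set"
  assumes pos: "0 < \<alpha>" "0 < s" "0 < C"
    and Holder: "\<And>x y. x \<in> E \<Longrightarrow> y \<in> E \<Longrightarrow> D x y \<le> C * dist x y powr \<alpha>"
  shows "hausdorff_measure D (s / \<alpha>) E \<le> ennreal (C powr (s / \<alpha>)) * hausdorff_measure dist s E"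
proof (cases "hausdorff_measure dist s E = \<infinity>")
  case True
  then show ?thesis using pos by (simp add: ennreal_mult_top)
next
  case False
  show ?thesis
  proof (rule hausdorff_measure_leI, rule ennreal_le_cmult_epsilon)
    fix \<rho> e :: real assume "0 < \<rho>" "0 < e"
    \<comment> \<open>Chosen so that \<open>C * \<delta> powr \<alpha> = \<rho> / 2\<close>, which
      keeps the pieces admissible at scale \<open>\<rho>\<close>.\<close>
    define \<delta> where "\<delta> = (\<rho> / (2 * C)) powr (1 / \<alpha>)"
    have "0 < \<delta>" using pos \<open>0 < \<rho>\<close> by (simp add: \<delta>_def)
    have \<delta>: "C * \<delta> powr \<alpha> < \<rho>" using pos \<open>0 < \<rho>\<close> by (simp add: \<delta>_def powr_powr)
    have fin: "hausdorff_measure dist s E < \<infinity>" using False by (simp add: less_top)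
    obtain V t where V1: "E \<subseteq> (\<Union>j::nat. V j)"
      and t: "\<And>j. 0 \<le> t j" "\<And>j. t j < \<delta>"
      and V2: "\<And>j x y. x \<in> V j \<Longrightarrow> y \<in> V j \<Longrightarrow> dist x y \<le> t j"
      and V3: "(\<Sum>j. ennreal (t j powr s)) \<le> hausdorff_measure dist s E + ennreal e"
      by (rule hausdorff_measure_approx[OF fin \<open>0 < \<delta>\<close> \<open>0 < e\<close>]) (rule that)
    have D: "D x y \<le> C * t j powr \<alpha>" if "x \<in> E \<inter> V j" "y \<in> E \<inter> V j" for x y j
    proof -
      have "D x y \<le> C * dist x y powr \<alpha>" using that Holder by blast
      also have "\<dots> \<le> C * t j powr \<alpha>"
        using that V2[of x j y] pos by (intro mult_left_mono powr_mono2) auto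
      finally show ?thesis .
    qed
    have content: "hausdorff_content D (s / \<alpha>) \<rho> (E \<inter> V j) \<le> ennreal (C powr (s / \<alpha>)) * ennreal (t j powr s)" for j
    proof -
      have "hausdorff_content D (s / \<alpha>) \<rho> (E \<inter> V j) \<le> ennreal ((C * t j powr \<alpha>) powr (s / \<alpha>))"
      proof (rule hausdorff_content_le_diam[OF D])
        have "C * t j powr \<alpha> \<le> C * \<delta> powr \<alpha>"
          using t[of j] pos by (intro mult_left_mono powr_mono2) auto
        then show "C * t j powr \<alpha> < \<rho>" using \<delta> by linarith
      qed (use pos in auto)
      also have "(C * t j powr \<alpha>) powr (s / \<alpha>) = C powr (s / \<alpha>) * t j powr s"
        using pos by (simp add: powr_mult powr_powr)
      finally show ?thesis by (simp add: ennreal_mult')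
    qed
    have "hausdorff_content D (s / \<alpha>) \<rho> E \<le> hausdorff_content D (s / \<alpha>) \<rho> (\<Union>j. E \<inter> V j)"
      using V1 by (intro hausdorff_content_mono) auto
    also have "\<dots> \<le> (\<Sum>j. hausdorff_content D (s / \<alpha>) \<rho> (E \<inter> V j))"
      by (rule hausdorff_content_UN)
    also have "\<dots> \<le> (\<Sum>j. ennreal (C powr (s / \<alpha>)) * ennreal (t j powr s))"
      by (intro suminf_le content) auto
    also have "\<dots> = ennreal (C powr (s / \<alpha>)) * (\<Sum>j. ennreal (t j powr s))"
      by (rule ennreal_suminf_cmult)
    also have "\<dots> \<le> ennreal (C powr (s / \<alpha>)) * (hausdorff_measure dist s E + ennreal e)"
      using V3 by (intro mult_left_mono) simp_all
    finally show "hausdorff_content D (s / \<alpha>) \<rho> E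
      \<le> ennreal (C powr (s / \<alpha>)) * (hausdorff_measure dist s E + ennreal e)" .
  qed simp
qed

text \<open>With a common scale \<open>r\<^sub>0\<close>, every member of a fine cover of
  \<open>E\<close> lies in a ball centred in \<open>E\<close> to which \<open>conc\<close> applies.
  The first summand of the constant comes from the \<open>D\<close>-ball, used as a single covering
  set; the second comes from the remainder through the Hoelder estimate.\<close>

lemma hausdorff_measure_le_of_concentration:
  fixes A :: "'a::metric_space set"
  assumes "Metric_space UNIV D"
    and pos: "0 < \<alpha>" "0 < s" "0 < C" "0 < \<kappa>" "0 \<le> \<eta>" "0 < r\<^sub>0"
    and Holder: "\<And>x y. x \<in> A \<Longrightarrow> y \<in> A \<Longrightarrow> D x y \<le> C * dist x y powr \<alpha>"
    and "E \<subseteq> A"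
    and conc: "\<And>p r. p \<in> E \<Longrightarrow> 0 < r \<Longrightarrow> r < r\<^sub>0 \<Longrightarrow>
      hausdorff_measure dist s (A \<inter> cball p r - {q. D p q \<le> \<kappa> * r powr \<alpha>}) \<le> ennreal (\<eta> * r powr s)"
  shows "hausdorff_measure D (s / \<alpha>) E
    \<le> ennreal ((2 * \<kappa>) powr (s / \<alpha>) + C powr (s / \<alpha>) * \<eta>) * hausdorff_measure dist s E"
proof (cases "hausdorff_measure dist s E = \<infinity>")
  case True
  have "0 < (2 * \<kappa>) powr (s / \<alpha>) + C powr (s / \<alpha>) * \<eta>"
    using pos by (intro add_pos_nonneg) auto
  then show ?thesis using True by (simp add: ennreal_mult_top)
next
  case False
  interpret D: Metric_space UNIV D by fact
  let ?K = "(2 * \<kappa>) powr (s / \<alpha>) + C powr (s / \<alpha>) * \<eta>"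
  have K: "0 \<le> ?K" using pos by simp
  show ?thesis
  proof (rule hausdorff_measure_leI, rule ennreal_le_cmult_epsilon[OF _ K])
    fix \<rho> e :: real assume "0 < \<rho>" "0 < e"
    \<comment> \<open>Radii below \<open>r\<^sub>0\<close> allow the use of \<open>conc\<close>; the
      other bound makes the \<open>D\<close>-diameter \<open>2 * \<kappa> * r powr \<alpha>\<close>
      at most \<open>\<rho> / 2\<close>.\<close>
    define \<delta> where "\<delta> = min r\<^sub>0 ((\<rho> / (4 * \<kappa>)) powr (1 / \<alpha>))"
    have "0 < \<delta>" using pos \<open>0 < \<rho>\<close> by (simp add: \<delta>_def)
    have \<delta>: "2 * \<kappa> * r powr \<alpha> < \<rho>" if "0 < r" "r < \<delta>" for r
    proof -
      have "r powr \<alpha> \<le> ((\<rho> / (4 * \<kappa>)) powr (1 / \<alpha>)) powr \<alpha>"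
        using that pos by (intro powr_mono2) (auto simp: \<delta>_def)
      also have "\<dots> = \<rho> / (4 * \<kappa>)" using pos \<open>0 < \<rho>\<close> by (simp add: powr_powr)
      finally have "2 * \<kappa> * r powr \<alpha> \<le> 2 * \<kappa> * (\<rho> / (4 * \<kappa>))" using pos by (intro mult_left_mono) auto
      also have "\<dots> < \<rho>" using pos \<open>0 < \<rho>\<close> by simp
      finally show ?thesis .
    qed
    have piece: "hausdorff_content D (s / \<alpha>) \<rho> (E \<inter> cball p r) \<le> ennreal (?K * r powr s)"
      if "p \<in> E" "0 < r" "r < \<delta>" for p r
    proof -
      let ?S = "{q. D p q \<le> \<kappa> * r powr \<alpha>}"
      let ?R = "A \<inter> cball p r - ?S"
      have "hausdorff_content D (s / \<alpha>) \<rho> ?S \<le> ennreal ((2 * \<kappa> * r powr \<alpha>) powr (s / \<alpha>))"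
      proof (rule hausdorff_content_le_diam)
        fix x y assume "x \<in> ?S" "y \<in> ?S"
        then show "D x y \<le> 2 * \<kappa> * r powr \<alpha>"
          using D.triangle[of x p y] D.commute[of x p] by simp
      qed (use \<delta>[OF that(2,3)] pos in auto)
      also have "(2 * \<kappa> * r powr \<alpha>) powr (s / \<alpha>) = (2 * \<kappa>) powr (s / \<alpha>) * r powr s"
        using pos by (simp add: powr_mult powr_powr)
      finally have S: "hausdorff_content D (s / \<alpha>) \<rho> ?S \<le> ennreal ((2 * \<kappa>) powr (s / \<alpha>) * r powr s)" .
      have "hausdorff_content D (s / \<alpha>) \<rho> ?R \<le> hausdorff_measure D (s / \<alpha>) ?R"
        using \<open>0 < \<rho>\<close> by (rule hausdorff_content_le_measure)
      also have "\<dots> \<le> ennreal (C powr (s / \<alpha>)) * hausdorff_measure dist s ?R"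
        using Holder by (intro hausdorff_measure_Holder pos) auto
      also have "\<dots> \<le> ennreal (C powr (s / \<alpha>)) * ennreal (\<eta> * r powr s)"
        using that by (intro mult_left_mono conc) (auto simp: \<delta>_def)
      also have "\<dots> = ennreal (C powr (s / \<alpha>) * (\<eta> * r powr s))" by (simp add: ennreal_mult')
      finally have R: "hausdorff_content D (s / \<alpha>) \<rho> ?R \<le> ennreal (C powr (s / \<alpha>) * (\<eta> * r powr s))" .
      have "hausdorff_content D (s / \<alpha>) \<rho> (E \<inter> cball p r) \<le> hausdorff_content D (s / \<alpha>) \<rho> (?S \<union> ?R)"
        using \<open>E \<subseteq> A\<close> by (intro hausdorff_content_mono) auto
      also have "\<dots> \<le> hausdorff_content D (s / \<alpha>) \<rho> ?S + hausdorff_content D (s / \<alpha>) \<rho> ?R"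
        using \<open>0 < \<rho>\<close> by (rule hausdorff_content_Un)
      also have "\<dots> \<le> ennreal ((2 * \<kappa>) powr (s / \<alpha>) * r powr s) + ennreal (C powr (s / \<alpha>) * (\<eta> * r powr s))"
        by (intro add_mono S R)
      also have "\<dots> = ennreal (?K * r powr s)"
        using pos by (subst ennreal_plus[symmetric]) (auto simp: algebra_simps)
      finally show ?thesis .
    qed
    have fin: "hausdorff_measure dist s E < \<infinity>" using False by (simp add: less_top)
    \<comment> \<open>One half of the error pays for the cover, the other for enlarging the
      radii.\<close>
    have "0 < e / 2" using \<open>0 < e\<close> by simp
    obtain V t where V1: "E \<subseteq> (\<Union>j::nat. V j)"
      and t: "\<And>j. 0 \<le> t j" "\<And>j. t j < \<delta>"
      and V2: "\<And>j x y. x \<in> V j \<Longrightarrow> y \<in> V j \<Longrightarrow> dist x y \<le> t j"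
      and V3: "(\<Sum>j. ennreal (t j powr s)) \<le> hausdorff_measure dist s E + ennreal (e / 2)"
      by (rule hausdorff_measure_approx[OF fin \<open>0 < \<delta>\<close> \<open>0 < e / 2\<close>]) (rule that)
    \<comment> \<open>The diameters may vanish, so they are enlarged slightly to serve as radii.\<close>
    have "\<exists>r. t j \<le> r \<and> 0 < r \<and> r < \<delta> \<and> r powr s \<le> t j powr s + e / 2 * (1 / 2) ^ Suc j" for j
    proof (cases "t j = 0")
      case False
      then show ?thesis using t[of j] \<open>0 < e\<close> by (intro exI[of _ "t j"]) auto
    next
      case True
      let ?u = "e / 2 * (1 / 2) ^ Suc j"
      let ?r = "min (\<delta> / 2) (?u powr (1 / s))"
      have "?r powr s \<le> (?u powr (1 / s)) powr s"
        using \<open>0 < \<delta>\<close> pos by (intro powr_mono2) auto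
      also have "\<dots> = ?u" using pos \<open>0 < e\<close> by (simp add: powr_powr)
      finally show ?thesis using True \<open>0 < \<delta>\<close> \<open>0 < e\<close> pos by (intro exI[of _ ?r]) (auto simp: min_def)
    qed
    then obtain r where r: "\<And>j. t j \<le> r j" "\<And>j. 0 < r j" "\<And>j. r j < \<delta>"
      "\<And>j. r j powr s \<le> t j powr s + e / 2 * (1 / 2) ^ Suc j"
      by metis
    have pieces: "hausdorff_content D (s / \<alpha>) \<rho> (E \<inter> V j)
        \<le> ennreal ?K * (ennreal (t j powr s) + ennreal (e / 2 * (1 / 2) ^ Suc j))" for j
    proof (cases "E \<inter> V j = {}")
      case True
      then show ?thesis using \<open>0 < \<rho>\<close> by (simp add: hausdorff_content_empty)
    next
      case False
      then obtain p where p: "p \<in> E" "p \<in> V j" by blast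
      have "V j \<subseteq> cball p (r j)"
        using V2[OF p(2)] r(1)[of j] by (fastforce intro: order_trans)
      then have "hausdorff_content D (s / \<alpha>) \<rho> (E \<inter> V j) \<le> hausdorff_content D (s / \<alpha>) \<rho> (E \<inter> cball p (r j))"
        by (intro hausdorff_content_mono) auto
      also have "\<dots> \<le> ennreal (?K * r j powr s)" using p r by (intro piece) auto
      also have "\<dots> \<le> ennreal (?K * (t j powr s + e / 2 * (1 / 2) ^ Suc j))"
        using r(4)[of j] K by (intro ennreal_leI mult_left_mono) auto
      also have "\<dots> = ennreal ?K * (ennreal (t j powr s) + ennreal (e / 2 * (1 / 2) ^ Suc j))"
        using K \<open>0 < e\<close> by (subst ennreal_plus[symmetric]) (auto simp: ennreal_mult' simp del: power_Suc ennreal_plus)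
      finally show ?thesis .
    qed
    have "hausdorff_content D (s / \<alpha>) \<rho> E \<le> hausdorff_content D (s / \<alpha>) \<rho> (\<Union>j. E \<inter> V j)"
      using V1 by (intro hausdorff_content_mono) auto
    also have "\<dots> \<le> (\<Sum>j. hausdorff_content D (s / \<alpha>) \<rho> (E \<inter> V j))"
      by (rule hausdorff_content_UN)
    also have "\<dots> \<le> (\<Sum>j. ennreal ?K * (ennreal (t j powr s) + ennreal (e / 2 * (1 / 2) ^ Suc j)))"
      by (intro suminf_le pieces) auto
    also have "\<dots> = ennreal ?K * ((\<Sum>j. ennreal (t j powr s)) + ennreal (e / 2))"
      using suminf_geometric_half_ennreal[of "e / 2"] \<open>0 < e\<close>
      by (subst ennreal_suminf_cmult, subst suminf_add[symmetric]) (simp_all del: power_Suc suminf_ennreal2 suminf_ennreal)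
    also have "\<dots> \<le> ennreal ?K * ((hausdorff_measure dist s E + ennreal (e / 2)) + ennreal (e / 2))"
      using V3 by (intro mult_left_mono add_right_mono) simp_all
    also have "\<dots> = ennreal ?K * (hausdorff_measure dist s E + ennreal e)"
      using \<open>0 < e\<close> by (simp add: add.assoc ennreal_plus[symmetric] del: ennreal_plus)
    finally show "hausdorff_content D (s / \<alpha>) \<rho> E \<le> ennreal ?K * (hausdorff_measure dist s E + ennreal e)" .
  qed
qed

section \<open>From pointwise scales to a common scale\<close>

lemma concentration_closure:
  fixes A :: "'a::metric_space set"
  assumes "Metric_space UNIV D"
    and pos: "0 < \<alpha>" "0 < s" "0 < C" "0 < \<kappa>"
    and Holder: "\<And>x y. x \<in> A \<Longrightarrow> y \<in> A \<Longrightarrow> D x y \<le> C * dist x y powr \<alpha>"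
    and "Y \<subseteq> A"
    and conc: "\<And>p r. p \<in> Y \<Longrightarrow> 0 < r \<Longrightarrow> r < r\<^sub>0 \<Longrightarrow>
      hausdorff_measure dist s (A \<inter> cball p r - {q. D p q \<le> \<kappa> * r powr \<alpha>}) \<le> ennreal (\<eta> * r powr s)"
    and p: "p \<in> A" "p \<in> closure Y" and r: "0 < r" "r < r\<^sub>0 / 2"
  shows "hausdorff_measure dist s (A \<inter> cball p r - {q. D p q \<le> (2 * \<kappa> * 2 powr \<alpha>) * r powr \<alpha>})
    \<le> ennreal ((\<eta> * 2 powr s) * r powr s)"
proof -
  interpret D: Metric_space UNIV D by fact
  let ?\<kappa>r = "\<kappa> * (2 * r) powr \<alpha>"
  \<comment> \<open>The bound \<open>r\<close> places \<open>cball p r\<close> inside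
    \<open>cball p' (2 * r)\<close>; the other makes the Hoelder estimate give
    \<open>D p p' \<le> ?\<kappa>r\<close>.\<close>
  let ?u = "min r ((?\<kappa>r / C) powr (1 / \<alpha>))"
  have "0 < ?u" using pos r by simp
  then obtain p' where p': "p' \<in> Y" "dist p' p < ?u" using p(2) closure_approachable by blast
  have "D p p' \<le> C * dist p p' powr \<alpha>" using p p'(1) \<open>Y \<subseteq> A\<close> Holder by blast
  also have "\<dots> \<le> C * ((?\<kappa>r / C) powr (1 / \<alpha>)) powr \<alpha>"
    using p'(2) pos by (intro mult_left_mono powr_mono2) (auto simp: dist_commute)
  also have "\<dots> = ?\<kappa>r" using pos r by (simp add: powr_powr)
  finally have pp': "D p p' \<le> ?\<kappa>r" .
  \<comment> \<open>The \<open>D\<close>-ball of radius \<open>?\<kappa>r\<close> about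
    \<open>p'\<close> lies in the one of twice that radius about \<open>p\<close>. Applying
    \<open>conc\<close> at radius \<open>2 * r\<close> accounts for the factors
    \<open>2 powr \<alpha>\<close>, \<open>2 powr s\<close> and the halved scale.\<close>
  have "A \<inter> cball p r - {q. D p q \<le> (2 * \<kappa> * 2 powr \<alpha>) * r powr \<alpha>}
      \<subseteq> A \<inter> cball p' (2 * r) - {q. D p' q \<le> ?\<kappa>r}"
  proof
    fix q assume q: "q \<in> A \<inter> cball p r - {q. D p q \<le> (2 * \<kappa> * 2 powr \<alpha>) * r powr \<alpha>}"
    have "dist p' q \<le> 2 * r" using q p'(2) dist_triangle[of p' q p] by auto
    moreover have "\<not> D p' q \<le> ?\<kappa>r"
      using q pp' D.triangle[of p p' q] r by (auto simp: powr_mult)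
    ultimately show "q \<in> A \<inter> cball p' (2 * r) - {q. D p' q \<le> ?\<kappa>r}" using q by auto
  qed
  then have "hausdorff_measure dist s (A \<inter> cball p r - {q. D p q \<le> (2 * \<kappa> * 2 powr \<alpha>) * r powr \<alpha>})
      \<le> hausdorff_measure dist s (A \<inter> cball p' (2 * r) - {q. D p' q \<le> ?\<kappa>r})"
    by (rule hausdorff_measure_mono)
  also have "\<dots> \<le> ennreal (\<eta> * (2 * r) powr s)" using p'(1) r by (intro conc) auto
  also have "\<eta> * (2 * r) powr s = (\<eta> * 2 powr s) * r powr s" using r by (simp add: powr_mult)
  finally show ?thesis .
qed

theorem hausdorff_measure_zero_of_concentration:
  fixes A :: "'a::metric_space set"
  assumes D: "Metric_space UNIV D"
    and pos: "0 < \<alpha>" "0 < s" "0 < C"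
    and Holder: "\<And>x y. x \<in> A \<Longrightarrow> y \<in> A \<Longrightarrow> D x y \<le> C * dist x y powr \<alpha>"
    and fin: "hausdorff_measure dist s A < \<infinity>"
    and "B \<subseteq> A"
    and conc: "\<And>p \<kappa> \<eta>. p \<in> B \<Longrightarrow> 0 < \<kappa> \<Longrightarrow> 0 < \<eta> \<Longrightarrow>
      \<forall>\<^sub>F r in at_right 0. hausdorff_measure dist s (A \<inter> cball p r - {q. D p q \<le> \<kappa> * r powr \<alpha>})
        \<le> ennreal (\<eta> * r powr s)"
  shows "hausdorff_measure D (s / \<alpha>) B = 0"
proof -
  let ?H = "hausdorff_measure dist s"
  have bound: "hausdorff_measure D (s / \<alpha>) B \<le> ennreal e * ?H A" if "0 < e" for e
  proof -
    \<comment> \<open>After the losses of passing to closures, each of the two summands in the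
      constant of \<open>hausdorff_measure_le_of_concentration\<close> equals
      \<open>e / 2\<close>.\<close>
    define \<kappa> where "\<kappa> = (e / 2) powr (\<alpha> / s) / (4 * 2 powr \<alpha>)"
    define \<eta> where "\<eta> = e / (2 * C powr (s / \<alpha>) * 2 powr s)"
    have \<kappa>\<eta>: "0 < \<kappa>" "0 < \<eta>" using that pos by (simp_all add: \<kappa>_def \<eta>_def)
    define Y where "Y = (\<lambda>m::nat. {p \<in> A. \<forall>r. 0 < r \<longrightarrow> r < 1 / real (Suc m) \<longrightarrow>
      ?H (A \<inter> cball p r - {q. D p q \<le> \<kappa> * r powr \<alpha>}) \<le> ennreal (\<eta> * r powr s)})"
    \<comment> \<open>The sets \<open>E m\<close> are traces on \<open>A\<close> of differences of
      closed sets, so their measures sum to at most that of \<open>A\<close>, although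
      \<open>A\<close> need not be measurable.\<close>
    define E where "E = (\<lambda>m. A \<inter> (closure (Y m) - (\<Union>i<m. closure (Y i))))"
    have "B \<subseteq> (\<Union>m. E m)"
    proof
      fix p assume "p \<in> B"
      from conc[OF this \<kappa>\<eta>] obtain b where b: "0 < b" "\<And>r. 0 < r \<Longrightarrow> r < b \<Longrightarrow>
          ?H (A \<inter> cball p r - {q. D p q \<le> \<kappa> * r powr \<alpha>}) \<le> ennreal (\<eta> * r powr s)"
        by (auto simp: eventually_at_right_field)
      obtain m where "inverse (real (Suc m)) < b" using reals_Archimedean b(1) by blast
      then have "p \<in> Y m" using b(2) \<open>p \<in> B\<close> \<open>B \<subseteq> A\<close> by (auto simp: Y_def inverse_eq_divide)
      then have cl: "p \<in> closure (Y m)" using closure_subset by blast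
      define n where "n = (LEAST n. p \<in> closure (Y n))"
      have "p \<in> closure (Y n)" unfolding n_def using cl by (rule LeastI)
      moreover have "p \<notin> closure (Y i)" if "i < n" for i
        using that not_less_Least unfolding n_def by blast
      ultimately show "p \<in> (\<Union>m. E m)" using \<open>p \<in> B\<close> \<open>B \<subseteq> A\<close> by (auto simp: E_def)
    qed
    have E: "hausdorff_measure D (s / \<alpha>) (E m) \<le> ennreal e * ?H (E m)" for m
    proof -
      have "hausdorff_measure D (s / \<alpha>) (E m) \<le>
        ennreal ((2 * (2 * \<kappa> * 2 powr \<alpha>)) powr (s / \<alpha>) + C powr (s / \<alpha>) * (\<eta> * 2 powr s)) * ?H (E m)"
      proof (rule hausdorff_measure_le_of_concentration[OF D pos _ _ _ Holder,
            where r\<^sub>0 = "1 / real (Suc m) / 2" and A = A])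
        fix p :: 'a and r :: real assume p: "p \<in> E m" and r: "0 < r" "r < 1 / real (Suc m) / 2"
        show "?H (A \<inter> cball p r - {q. D p q \<le> 2 * \<kappa> * 2 powr \<alpha> * r powr \<alpha>})
          \<le> ennreal (\<eta> * 2 powr s * r powr s)"
          by (rule concentration_closure[OF D pos \<kappa>\<eta>(1) Holder, where Y = "Y m"
                and r\<^sub>0 = "1 / real (Suc m)"])
            (use p r in \<open>auto simp: Y_def E_def\<close>)
      qed (use \<kappa>\<eta> in \<open>auto simp: E_def\<close>)
      also have "(2 * (2 * \<kappa> * 2 powr \<alpha>)) powr (s / \<alpha>) = e / 2"
        using that pos by (simp add: \<kappa>_def powr_powr)
      also have "C powr (s / \<alpha>) * (\<eta> * 2 powr s) = e / 2"
        using pos by (simp add: \<eta>_def)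
      finally show ?thesis by simp
    qed
    have "hausdorff_measure D (s / \<alpha>) B \<le> hausdorff_measure D (s / \<alpha>) (\<Union>m. E m)"
      by (rule hausdorff_measure_mono) fact
    also have "\<dots> \<le> (\<Sum>m. hausdorff_measure D (s / \<alpha>) (E m))" by (rule hausdorff_measure_UN)
    also have "\<dots> \<le> (\<Sum>m. ennreal e * ?H (E m))" by (intro suminf_le E) auto
    also have "\<dots> = ennreal e * (\<Sum>m. ?H (E m))" by (rule ennreal_suminf_cmult)
    also have "\<dots> \<le> ennreal e * ?H A"
      unfolding E_def using fin by (intro mult_left_mono sum_hausdorff_measure_closed_chain) auto
    finally show ?thesis .
  qed
  define h where "h = enn2real (?H A)"
  have h: "?H A = ennreal h" "0 \<le> h" using fin by (simp_all add: h_def)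
  have "hausdorff_measure D (s / \<alpha>) B \<le> 0"
  proof (rule ennreal_le_epsilon)
    fix e :: real assume "0 < e"
    then have "hausdorff_measure D (s / \<alpha>) B \<le> ennreal (e / (h + 1)) * ennreal h"
      using bound[of "e / (h + 1)"] h by simp
    also have "\<dots> = ennreal (e / (h + 1) * h)" using h \<open>0 < e\<close> by (intro ennreal_mult'[symmetric]) simp
    also have "\<dots> \<le> ennreal e" using h \<open>0 < e\<close> by (intro ennreal_leI) (simp add: field_simps)
    finally show "hausdorff_measure D (s / \<alpha>) B \<le> 0 + ennreal e" by simp
  qed
  then show ?thesis by simp
qed

section \<open>Carnot groups\<close>

text \<open>Boundedness is proved along with the Lipschitz estimate because the product case needs
  bounds on the factors. For empty \<open>S\<close> the bound \<open>M\<close> may be negative,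
  hence the absolute values there.\<close>

lemma real_polynomial_function_bounded_Lipschitz:
  assumes "real_polynomial_function f" "bounded S"
  shows "\<exists>L M. 0 \<le> L \<and> (\<forall>x\<in>S. \<bar>f x\<bar> \<le> M) \<and> (\<forall>x\<in>S. \<forall>y\<in>S. \<bar>f x - f y\<bar> \<le> L * dist x y)"
  using assms(1)
proof induction
  case (linear f)
  interpret bounded_linear f by fact
  obtain K where K: "0 \<le> K" "\<And>x. norm (f x) \<le> norm x * K" using nonneg_bounded by blast
  obtain b where b: "\<And>x. x \<in> S \<Longrightarrow> norm x \<le> b" using \<open>bounded S\<close> bounded_iff by blast
  show ?case
  proof (rule exI[of _ K], rule exI[of _ "b * K"], intro conjI ballI)
    show "\<bar>f x\<bar> \<le> b * K" if "x \<in> S" for x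
      using K(2)[of x] mult_right_mono[OF b[OF that] K(1)] by simp
    show "\<bar>f x - f y\<bar> \<le> K * dist x y"
      for x y using K(2)[of "x - y"] by (simp add: diff dist_norm mult.commute)
  qed fact
next
  case (const c)
  then show ?case by (intro exI[of _ "0::real"] exI[of _ "\<bar>c\<bar>"]) auto
next
  case (add f g)
  then obtain L M L' M' where f: "0 \<le> L" "\<forall>x\<in>S. \<bar>f x\<bar> \<le> M" "\<forall>x\<in>S. \<forall>y\<in>S. \<bar>f x - f y\<bar> \<le> L * dist x y"
    and g: "0 \<le> L'" "\<forall>x\<in>S. \<bar>g x\<bar> \<le> M'" "\<forall>x\<in>S. \<forall>y\<in>S. \<bar>g x - g y\<bar> \<le> L' * dist x y"
    by blast
  show ?case
  proof (rule exI[of _ "L + L'"], rule exI[of _ "M + M'"], intro conjI ballI)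
    fix x y assume "x \<in> S" "y \<in> S"
    then have "\<bar>f x - f y\<bar> \<le> L * dist x y" "\<bar>g x - g y\<bar> \<le> L' * dist x y" using f g by blast+
    then show "\<bar>f x + g x - (f y + g y)\<bar> \<le> (L + L') * dist x y" by (simp add: distrib_right)
  qed (use f g in \<open>fastforce+\<close>)
next
  case (mult f g)
  then obtain L M L' M' where f: "0 \<le> L" "\<forall>x\<in>S. \<bar>f x\<bar> \<le> M" "\<forall>x\<in>S. \<forall>y\<in>S. \<bar>f x - f y\<bar> \<le> L * dist x y"
    and g: "0 \<le> L'" "\<forall>x\<in>S. \<bar>g x\<bar> \<le> M'" "\<forall>x\<in>S. \<forall>y\<in>S. \<bar>g x - g y\<bar> \<le> L' * dist x y"
    by blast
  show ?case
  proof (rule exI[of _ "\<bar>M\<bar> * L' + L * \<bar>M'\<bar>"], rule exI[of _ "\<bar>M\<bar> * \<bar>M'\<bar>"], intro conjI ballI)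
    have b: "\<bar>f x\<bar> \<le> \<bar>M\<bar>" "\<bar>g x\<bar> \<le> \<bar>M'\<bar>" if "x \<in> S" for x
      using f g that by fastforce+
    show "\<bar>f x * g x\<bar> \<le> \<bar>M\<bar> * \<bar>M'\<bar>" if "x \<in> S" for x
      unfolding abs_mult using b[OF that] by (intro mult_mono) auto
    fix x y assume xy: "x \<in> S" "y \<in> S"
    have "f x * g x - f y * g y = f x * (g x - g y) + (f x - f y) * g y" by (simp add: algebra_simps)
    then have "\<bar>f x * g x - f y * g y\<bar> \<le> \<bar>f x\<bar> * \<bar>g x - g y\<bar> + \<bar>f x - f y\<bar> * \<bar>g y\<bar>"
      by (metis abs_triangle_ineq abs_mult)
    also have "\<dots> \<le> \<bar>M\<bar> * (L' * dist x y) + (L * dist x y) * \<bar>M'\<bar>"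
      using b f g xy by (intro add_mono mult_mono) auto
    finally show "\<bar>f x * g x - f y * g y\<bar> \<le> (\<bar>M\<bar> * L' + L * \<bar>M'\<bar>) * dist x y"
      by (simp add: algebra_simps)
  qed (use f g in auto)
qed

lemma norm_block_le: "norm (block deg j p) \<le> norm p"
  by (rule norm_le_componentwise_cart) (simp add: block_def)

text \<open>After scaling by \<open>M\<close> the argument lies in the unit interval, where roots
  grow with their order. Thus \<open>1 / k\<close> is the worst exponent among all blocks.\<close>

lemma root_le_powr:
  assumes "0 \<le> y" "y \<le> M" "1 \<le> M" "1 \<le> j" "j \<le> k"
  shows "root j y \<le> M * y powr (1 / real k)"
proof (cases "y = 0")
  case False
  have "root j y = (M * (y / M)) powr (1 / real j)"
    using False assms by (simp add: root_powr_inverse)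
  also have "\<dots> = M powr (1 / real j) * (y / M) powr (1 / real j)"
    using assms by (intro powr_mult)
  also have "\<dots> \<le> M powr 1 * (y / M) powr (1 / real k)"
    using assms by (intro mult_mono powr_mono powr_mono') (auto simp: divide_simps)
  also have "\<dots> \<le> M powr 1 * y powr (1 / real k)"
    using assms mult_left_mono[of 1 M y] by (intro mult_left_mono powr_mono2) (auto simp: divide_simps mult.commute)
  finally show ?thesis using assms by simp
qed (use assms in auto)

context carnot_group
begin

section \<open>Hoelder continuity of the homogeneous metric on bounded sets\<close>

lemma homogeneous_norm_le_powr:
  assumes \<epsilon>: "\<And>j. 2 \<le> j \<Longrightarrow> j \<le> k \<Longrightarrow> 0 < \<epsilon> j \<and> \<epsilon> j < 1"
    and "norm x \<le> M" "1 \<le> M"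
  shows "homogeneous_norm k deg \<epsilon> x \<le> M * norm x powr (1 / real k)"
proof -
  have root: "root j (norm (block deg j x)) \<le> M * norm x powr (1 / real k)" if "1 \<le> j" "j \<le> k" for j
  proof -
    have "root j (norm (block deg j x)) \<le> root j (norm x)"
      using that norm_block_le by (intro real_root_le_mono) auto
    also have "\<dots> \<le> M * norm x powr (1 / real k)" using assms that by (intro root_le_powr) auto
    finally show ?thesis .
  qed
  have "\<epsilon> j * root j (norm (block deg j x)) \<le> M * norm x powr (1 / real k)" if "2 \<le> j" "j \<le> k" for j
  proof -
    have "\<epsilon> j * root j (norm (block deg j x)) \<le> 1 * root j (norm (block deg j x))"
      using \<epsilon>[OF that] that by (intro mult_right_mono) auto
    then show ?thesis using root[of j] that by simp
  qed
  then show ?thesis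
    using root[of 1] step by (auto simp: homogeneous_norm_def)
qed

lemma homogeneous_norm_layer_1:
  assumes "v \<in> layer deg 1"
  shows "homogeneous_norm k deg \<epsilon> v = norm v"
proof -
  have "block deg 1 v = v" using assms by (auto simp: block_def layer_def vec_eq_iff)
  moreover have "block deg j v = 0" if "2 \<le> j" for j
    using assms that by (auto simp: block_def layer_def vec_eq_iff)
  ultimately show ?thesis
    unfolding homogeneous_norm_def by (intro Max_eqI) auto
qed

lemma P_first_block: "deg i = 1 \<Longrightarrow> P p q $ i = 0"
  using P_lower[of i p p q 0] deg_range(1) P_right by (metis not_less zero_index)

text \<open>The polynomial part \<open>P (- q) p\<close> vanishes at \<open>p = q\<close> by
  \<open>P_antidiag\<close>. Comparing its values at \<open>(- q, p)\<close> and
  \<open>(- q, q)\<close>, which are \<open>dist p q\<close> apart, turns a local Lipschitz bound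
  into a linear estimate.\<close>

lemma norm_gmult_uminus_le:
  assumes "0 \<le> R"
  obtains L where "0 \<le> L"
    "\<And>p q. p \<in> cball 0 R \<Longrightarrow> q \<in> cball 0 R \<Longrightarrow> norm (gmult P (- q) p) \<le> (1 + L) * dist p q"
proof -
  let ?S = "(cball 0 R :: (real ^ 'n) set) \<times> (cball 0 R :: (real ^ 'n) set)"
  have "bounded ?S" by (intro bounded_Times) auto
  then have "\<exists>l\<ge>0. \<forall>x\<in>?S. \<forall>y\<in>?S.
      \<bar>(case x of (p, q) \<Rightarrow> P p q $ i) - (case y of (p, q) \<Rightarrow> P p q $ i)\<bar> \<le> l * dist x y" for i
    using real_polynomial_function_bounded_Lipschitz[OF P_polynomial[of i]] by meson
  then obtain l where l: "\<And>i. 0 \<le> l i" "\<And>i x y. x \<in> ?S \<Longrightarrow> y \<in> ?S \<Longrightarrow>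
      \<bar>(case x of (p, q) \<Rightarrow> P p q $ i) - (case y of (p, q) \<Rightarrow> P p q $ i)\<bar> \<le> l i * dist x y"
    by metis
  show thesis
  proof (rule that[of "\<Sum>i\<in>UNIV. l i"])
    show "0 \<le> (\<Sum>i\<in>UNIV. l i)" using l(1) by (intro sum_nonneg) auto
    fix p q :: "real ^ 'n" assume pq: "p \<in> cball 0 R" "q \<in> cball 0 R"
    have "\<bar>P (- q) p $ i\<bar> \<le> l i * dist p q" for i
      using l(2)[of "(- q, p)" "(- q, q)" i] pq P_antidiag[of "- q"] by (simp add: dist_Pair_Pair)
    then have "norm (P (- q) p) \<le> (\<Sum>i\<in>UNIV. l i * dist p q)"
      by (intro order_trans[OF norm_le_l1_cart] sum_mono)
    then have P: "norm (P (- q) p) \<le> (\<Sum>i\<in>UNIV. l i) * dist p q" by (simp add: sum_distrib_right)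
    have "gmult P (- q) p = (p - q) + P (- q) p" by (simp add: gmult_def)
    then have "norm (gmult P (- q) p) \<le> dist p q + norm (P (- q) p)"
      by (simp add: dist_norm norm_triangle_ineq)
    also have "\<dots> \<le> (1 + (\<Sum>i\<in>UNIV. l i)) * dist p q" using P by (simp add: distrib_right)
    finally show "norm (gmult P (- q) p) \<le> (1 + (\<Sum>i\<in>UNIV. l i)) * dist p q" .
  qed
qed

lemma dist_inf_Holder:
  assumes \<epsilon>: "\<And>j. 2 \<le> j \<Longrightarrow> j \<le> k \<Longrightarrow> 0 < \<epsilon> j \<and> \<epsilon> j < 1" and "0 \<le> R"
  obtains C where "0 < C"
    "\<And>p q. p \<in> cball 0 R \<Longrightarrow> q \<in> cball 0 R \<Longrightarrow> dist_inf k deg P \<epsilon> p q \<le> C * dist p q powr (1 / real k)"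
proof -
  obtain L where L: "0 \<le> L"
    "\<And>p q. p \<in> cball 0 R \<Longrightarrow> q \<in> cball 0 R \<Longrightarrow> norm (gmult P (- q) p) \<le> (1 + L) * dist p q"
    using norm_gmult_uminus_le[OF \<open>0 \<le> R\<close>] by metis
  \<comment> \<open>On the ball the group difference has norm at most
    \<open>(1 + L) * (2 * R)\<close>; the extra 1 ensures \<open>1 \<le> M\<close>.\<close>
  define M where "M = 1 + (1 + L) * (2 * R)"
  have "1 \<le> M" using L(1) \<open>0 \<le> R\<close> by (simp add: M_def)
  show thesis
  proof (rule that[of "M * (1 + L) powr (1 / real k)"])
    show "0 < M * (1 + L) powr (1 / real k)" using L(1) \<open>1 \<le> M\<close> by (simp add: mult_pos_pos)
    fix p q :: "real ^ 'n" assume pq: "p \<in> cball 0 R" "q \<in> cball 0 R"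
    let ?x = "gmult P (- q) p"
    have "dist p q \<le> 2 * R" using pq dist_triangle[of p q 0] by simp
    then have "norm ?x \<le> (1 + L) * (2 * R)"
      using L(1) by (intro order_trans[OF L(2)[OF pq]] mult_left_mono) auto
    then have "dist_inf k deg P \<epsilon> p q \<le> M * norm ?x powr (1 / real k)"
      unfolding dist_inf_def using \<open>1 \<le> M\<close>
      by (intro homogeneous_norm_le_powr \<epsilon>) (auto simp: M_def)
    also have "\<dots> \<le> M * ((1 + L) * dist p q) powr (1 / real k)"
      using \<open>1 \<le> M\<close> L(2)[OF pq] by (intro mult_left_mono powr_mono2) auto
    also have "\<dots> = M * (1 + L) powr (1 / real k) * dist p q powr (1 / real k)"
      using L(1) by (simp add: powr_mult)
    finally show "dist_inf k deg P \<epsilon> p q \<le> M * (1 + L) powr (1 / real k) * dist p q powr (1 / real k)" .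
  qed
qed

section \<open>Points near a horizontal plane\<close>

lemma dist_inf_horizontal:
  assumes "v \<in> layer deg 1"
  shows "dist_inf k deg P \<epsilon> (gmult P p v) p = norm v" "norm v \<le> dist (gmult P p v) p"
proof -
  \<comment> \<open>Left translation cancels \<open>p\<close> and leaves a horizontal vector, whose
    homogeneous norm is Euclidean.\<close>
  have "gmult P (- p) (gmult P p v) = v"
    by (simp add: assoc[symmetric])
  then show "dist_inf k deg P \<epsilon> (gmult P p v) p = norm v"
    unfolding dist_inf_def by (simp only: homogeneous_norm_layer_1[OF assms])
  show "norm v \<le> dist (gmult P p v) p"
    unfolding dist_norm
  \<comment> \<open>The group law is additive in the first block, so \<open>gmult P p v - p\<close>
    has the coordinates of \<open>v\<close> there; the other coordinates of \<open>v\<close> are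
    0.\<close>
  proof (rule norm_le_componentwise_cart)
    fix i
    show "norm (v $ i) \<le> norm ((gmult P p v - p) $ i)"
      using assms P_first_block[of i p v] by (cases "deg i = 1") (auto simp: gmult_def layer_def)
  qed
qed

text \<open>The path from \<open>p\<close> to \<open>q\<close> goes through a point \<open>w\<close>
  of the plane: the horizontal displacement to \<open>w\<close> costs only its Euclidean length, and
  the short step from \<open>w\<close> to \<open>q\<close> is the only one that pays the Hoelder
  rate.\<close>

lemma dist_inf_near_horizontal_plane:
  assumes D: "Metric_space UNIV (dist_inf k deg P \<epsilon>)"
    and C: "0 \<le> C" "\<And>p q. p \<in> cball 0 R \<Longrightarrow> q \<in> cball 0 R \<Longrightarrow> dist_inf k deg P \<epsilon> p q \<le> C * dist p q powr (1 / real k)"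
    and q: "q \<in> cball p r" "q \<in> euclidean_nbhd (horizontal_plane deg P p) (\<delta> * r)"
    and r: "0 < r" "0 < \<delta>" "\<delta> \<le> 1" "norm p + 3 * r \<le> R"
  shows "dist_inf k deg P \<epsilon> p q \<le> 3 * r + C * (2 * \<delta> * r) powr (1 / real k)"
proof -
  interpret D: Metric_space UNIV "dist_inf k deg P \<epsilon>" by fact
  have "0 \<in> layer deg 1" by (simp add: layer_def)
  then have ne: "horizontal_plane deg P p \<noteq> {}" by (auto simp: horizontal_plane_def)
  \<comment> \<open>Doubling makes the bound strict, so a nearby \<open>w\<close> exists without the
    infimum having to be attained.\<close>
  have "\<delta> * r < 2 * \<delta> * r" using r by simp
  then have "infdist q (horizontal_plane deg P p) < 2 * \<delta> * r"
    using q(2) by (simp add: euclidean_nbhd_def)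
  then obtain w where w: "w \<in> horizontal_plane deg P p" "dist q w < 2 * \<delta> * r"
    using ne by (auto simp: infdist_def cINF_less_iff)
  then obtain v where v: "v \<in> layer deg 1" "w = gmult P p v" by (auto simp: horizontal_plane_def)
  have "\<delta> * r \<le> 1 * r" using r by (intro mult_right_mono) auto
  then have wp: "dist w p \<le> 3 * r"
    using w(2) q(1) dist_triangle[of w p q] by (simp add: dist_commute)
  have "norm w \<le> R" using wp r(4) norm_triangle_sub[of w p] by (simp add: dist_norm)
  moreover have "norm q \<le> R" using q(1) r norm_triangle_sub[of q p] by (simp add: dist_norm norm_minus_commute)
  ultimately have "dist_inf k deg P \<epsilon> w q \<le> C * dist w q powr (1 / real k)" by (intro C(2)) auto
  also have "\<dots> \<le> C * (2 * \<delta> * r) powr (1 / real k)"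
    using w(2) C(1) by (intro mult_left_mono powr_mono2) (auto simp: dist_commute)
  finally have "dist_inf k deg P \<epsilon> w q \<le> C * (2 * \<delta> * r) powr (1 / real k)" .
  moreover have "dist_inf k deg P \<epsilon> p w \<le> 3 * r"
    using dist_inf_horizontal(1)[OF v(1), of \<epsilon> p] dist_inf_horizontal(2)[OF v(1), of p] wp D.commute[of p w] v(2) by simp
  moreover have "dist_inf k deg P \<epsilon> p q \<le> dist_inf k deg P \<epsilon> p w + dist_inf k deg P \<epsilon> w q"
    by (intro D.triangle) auto
  ultimately show ?thesis by linarith
qed

text \<open>Since \<open>k \<ge> 2\<close>, the term \<open>3 * r\<close> is negligible against
  \<open>r powr (1 / k)\<close>. The Hoelder term has exactly that order, and its coefficient is
  made small by the choice of \<open>\<delta>\<close>.\<close>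

lemma eventually_dist_inf_near_horizontal_plane:
  assumes D: "Metric_space UNIV (dist_inf k deg P \<epsilon>)"
    and \<epsilon>: "\<And>j. 2 \<le> j \<Longrightarrow> j \<le> k \<Longrightarrow> 0 < \<epsilon> j \<and> \<epsilon> j < 1" and "0 < \<kappa>"
  obtains \<delta> where "0 < \<delta>"
    "\<forall>\<^sub>F r in at_right 0. cball p r \<inter> euclidean_nbhd (horizontal_plane deg P p) (\<delta> * r)
      \<subseteq> {q. dist_inf k deg P \<epsilon> p q \<le> \<kappa> * r powr (1 / real k)}"
proof -
  obtain C where C: "0 < C" "\<And>x y. x \<in> cball 0 (norm p + 3) \<Longrightarrow> y \<in> cball 0 (norm p + 3) \<Longrightarrow>
      dist_inf k deg P \<epsilon> x y \<le> C * dist x y powr (1 / real k)"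
    using dist_inf_Holder[of \<epsilon> "norm p + 3", OF \<epsilon>] norm_ge_zero[of p] by (metis add_nonneg_nonneg zero_le_numeral)
  \<comment> \<open>This gives
    \<open>C * (2 * \<delta>) powr (1 / k) \<le> \<kappa> / 2\<close>.\<close>
  define \<delta> where "\<delta> = min 1 ((\<kappa> / (2 * C)) powr real k / 2)"
  have \<delta>: "0 < \<delta>" "\<delta> \<le> 1" using C(1) \<open>0 < \<kappa>\<close> by (auto simp: \<delta>_def)
  define a where "a = 1 - 1 / real k"
  have "0 < a" using step by (simp add: a_def field_simps)
  \<comment> \<open>For \<open>r < b\<close> the bound \<open>r powr a \<le> \<kappa> / 6\<close>
    gives \<open>3 * r \<le> \<kappa> / 2 * r powr (1 / k)\<close>; \<open>b \<le> 1\<close> keeps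
    all points in the ball where \<open>C\<close> is valid.\<close>
  define b where "b = min 1 ((\<kappa> / 6) powr (1 / a))"
  have "0 < b" using \<open>0 < \<kappa>\<close> by (simp add: b_def)
  show thesis
  proof (rule that[OF \<delta>(1)], unfold eventually_at_right_field, intro exI conjI allI impI subsetI)
    fix r q assume r: "0 < r" "r < b"
      and q: "q \<in> cball p r \<inter> euclidean_nbhd (horizontal_plane deg P p) (\<delta> * r)"
    have "r = r powr a * r powr (1 / real k)"
      using r by (simp add: a_def powr_add[symmetric])
    also have "r powr a \<le> ((\<kappa> / 6) powr (1 / a)) powr a"
      using r \<open>0 < a\<close> by (intro powr_mono2) (auto simp: b_def)
    also have "\<dots> = \<kappa> / 6" using \<open>0 < a\<close> \<open>0 < \<kappa>\<close> by (simp add: powr_powr)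
    finally have small: "3 * r \<le> \<kappa> / 2 * r powr (1 / real k)" by (simp add: mult_right_mono)
    have "(2 * \<delta>) powr (1 / real k) \<le> ((\<kappa> / (2 * C)) powr real k) powr (1 / real k)"
      using \<delta> by (intro powr_mono2) (auto simp: \<delta>_def)
    also have "\<dots> = \<kappa> / (2 * C)" using step C(1) \<open>0 < \<kappa>\<close> by (simp add: powr_powr)
    finally have "C * ((2 * \<delta>) powr (1 / real k) * r powr (1 / real k))
        \<le> C * (\<kappa> / (2 * C) * r powr (1 / real k))"
      using C(1) by (intro mult_left_mono mult_right_mono) auto
    then have "C * (2 * \<delta> * r) powr (1 / real k) \<le> \<kappa> / 2 * r powr (1 / real k)"
      using C(1) \<delta> r by (simp add: powr_mult)
    moreover have "dist_inf k deg P \<epsilon> p q \<le> 3 * r + C * (2 * \<delta> * r) powr (1 / real k)"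
      by (rule dist_inf_near_horizontal_plane[OF D _ C(2)]) (use q C(1) r \<delta> in \<open>auto simp: b_def\<close>)
    ultimately have "dist_inf k deg P \<epsilon> p q \<le> \<kappa> * r powr (1 / real k)" using small by linarith
    then show "q \<in> {q. dist_inf k deg P \<epsilon> p q \<le> \<kappa> * r powr (1 / real k)}" by simp
  qed fact
qed

end

section \<open>From vanishing density off the planes to concentration\<close>

theorem theorem9:
  fixes k :: nat
    and deg :: "'n::finite \<Rightarrow> nat"
    and P :: "real ^ 'n \<Rightarrow> real ^ 'n \<Rightarrow> real ^ 'n"
    and \<epsilon> :: "nat \<Rightarrow> real"
    and s :: real
    and A :: "(real ^ 'n) set"
  assumes "carnot_group k deg P"
    and "\<And>j. 2 \<le> j \<Longrightarrow> j \<le> k \<Longrightarrow> 0 < \<epsilon> j \<and> \<epsilon> j < 1"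
    and "Metric_space UNIV (dist_inf k deg P \<epsilon>)"
    and "0 < s" and "s < real (layer_dim deg k)"
    and "hausdorff_measure dist s A < \<infinity>"
  shows "hausdorff_measure (dist_inf k deg P \<epsilon>) (real k * s)
    {p \<in> A. \<not> (\<exists>\<delta>>0.
       Limsup (at_right 0) (\<lambda>r::real.
         hausdorff_measure dist s
           ((A \<inter> cball p r) - euclidean_nbhd (horizontal_plane deg P p) (\<delta> * r))
         / ennreal ((2 * r) powr s)) > 0)} = 0"
    (is "hausdorff_measure ?D _ ?B = 0")
proof -
  interpret carnot_group k deg P by fact
  let ?H = "hausdorff_measure dist s"
  let ?V = "\<lambda>p \<delta> r. euclidean_nbhd (horizontal_plane deg P p) (\<delta> * r)"
  have thin: "\<forall>\<^sub>F r in at_right 0. ?H ((A \<inter> cball p r) - ?V p \<delta> r) \<le> ennreal (\<eta> * r powr s)"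
    if "p \<in> ?B" "0 < \<delta>" "0 < \<eta>" for p \<delta> \<eta>
  proof -
    \<comment> \<open>Dividing by \<open>2 powr s\<close> compensates for the normalization by
      \<open>(2 * r) powr s\<close>.\<close>
    let ?\<eta> = "\<eta> / 2 powr s"
    have "Limsup (at_right 0) (\<lambda>r. ?H ((A \<inter> cball p r) - ?V p \<delta> r) / ennreal ((2 * r) powr s)) = 0"
      using that by auto
    also have "0 < ennreal ?\<eta>" using \<open>0 < \<eta>\<close> by simp
    finally have "\<forall>\<^sub>F r in at_right 0.
        ?H ((A \<inter> cball p r) - ?V p \<delta> r) / ennreal ((2 * r) powr s) < ennreal ?\<eta>"
      by (rule Limsup_lessD)
    moreover have "\<forall>\<^sub>F r in at_right 0. (0::real) < r"
      by (auto simp: eventually_at_right_field intro: exI[of _ 1])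
    ultimately show ?thesis
    proof eventually_elim
      case (elim r)
      let ?m = "?H ((A \<inter> cball p r) - ?V p \<delta> r)"
      have pos: "0 < (2 * r) powr s" using elim(2) by simp
      have "?m = ?m / ennreal ((2 * r) powr s) * ennreal ((2 * r) powr s)"
        using pos by (simp add: ennreal_divide_times ennreal_mult_divide_eq)
      also have "\<dots> \<le> ennreal ?\<eta> * ennreal ((2 * r) powr s)"
        by (intro mult_right_mono less_imp_le[OF elim(1)]) simp
      also have "\<dots> = ennreal (\<eta> * r powr s)"
        using elim(2) \<open>0 < \<eta>\<close> by (simp add: ennreal_mult[symmetric] powr_mult)
      finally show ?case .
    qed
  qed
  \<comment> \<open>The Hoelder constant is only local, so the exceptional set is exhausted by
    countably many bounded parts.\<close>
  have bounded_part: "hausdorff_measure ?D (real k * s) (?B \<inter> cball 0 (real N)) = 0" for N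
  proof -
    obtain C where C: "0 < C" "\<And>x y. x \<in> cball 0 (real N) \<Longrightarrow> y \<in> cball 0 (real N) \<Longrightarrow>
        ?D x y \<le> C * dist x y powr (1 / real k)"
      using dist_inf_Holder[of \<epsilon> "real N"] assms(2) by (metis of_nat_0_le_iff)
    \<comment> \<open>The general result is applied with \<open>\<alpha> = 1 / k\<close>, for which
      \<open>s / \<alpha> = k * s\<close>.\<close>
    have "hausdorff_measure ?D (s / (1 / real k)) (?B \<inter> cball 0 (real N)) = 0"
    proof (rule hausdorff_measure_zero_of_concentration[OF assms(3) _ \<open>0 < s\<close> C(1),
          where A = "A \<inter> cball 0 (real N)"])
      show "?H (A \<inter> cball 0 (real N)) < \<infinity>"
        using hausdorff_measure_mono[of "A \<inter> cball 0 (real N)" A dist s] assms(6)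
        by (auto intro: order_le_less_trans)
      fix p and \<kappa> \<eta> :: real assume p: "p \<in> ?B \<inter> cball 0 (real N)" and "0 < \<kappa>" "0 < \<eta>"
      \<comment> \<open>Here \<open>\<delta>\<close> depends on \<open>p\<close> and
        \<open>\<kappa>\<close>. This is harmless: at points of the exceptional set the upper
        density vanishes for every \<open>\<delta>\<close>.\<close>
      obtain \<delta> where "0 < \<delta>" and
        \<delta>: "\<forall>\<^sub>F r in at_right 0. cball p r \<inter> ?V p \<delta> r \<subseteq> {q. ?D p q \<le> \<kappa> * r powr (1 / real k)}"
        by (rule eventually_dist_inf_near_horizontal_plane[OF assms(3,2) \<open>0 < \<kappa>\<close>, where p = p]) (auto intro: that)
      have "\<forall>\<^sub>F r in at_right 0. ?H ((A \<inter> cball p r) - ?V p \<delta> r) \<le> ennreal (\<eta> * r powr s)"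
        using p \<open>0 < \<delta>\<close> \<open>0 < \<eta>\<close> by (intro thin) auto
      with \<delta> show "\<forall>\<^sub>F r in at_right 0.
          ?H (A \<inter> cball 0 (real N) \<inter> cball p r - {q. ?D p q \<le> \<kappa> * r powr (1 / real k)})
          \<le> ennreal (\<eta> * r powr s)"
      proof eventually_elim
        case (elim r)
        then have "A \<inter> cball 0 (real N) \<inter> cball p r - {q. ?D p q \<le> \<kappa> * r powr (1 / real k)}
            \<subseteq> (A \<inter> cball p r) - ?V p \<delta> r" by blast
        then show ?case using elim(2) by (rule order_trans[OF hausdorff_measure_mono])
      qed
    qed (use C step in auto)
    then show ?thesis by (simp add: mult.commute)
  qed
  have "X \<subseteq> (\<Union>N. X \<inter> cball 0 (real N))" for X :: "(real ^ 'n) set"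
    using real_arch_simple by fastforce
  then have "hausdorff_measure ?D (real k * s) ?B
      \<le> hausdorff_measure ?D (real k * s) (\<Union>N. ?B \<inter> cball 0 (real N))"
    by (rule hausdorff_measure_mono)
  also have "\<dots> \<le> (\<Sum>N. hausdorff_measure ?D (real k * s) (?B \<inter> cball 0 (real N)))"
    by (rule hausdorff_measure_UN)
  also have "\<dots> = 0" unfolding bounded_part by simp
  finally show ?thesis by simp
qed

end
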